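(* Let $n\geq1$ be an integer, $\gamma\in(1,n)$, and let $q_1,q_2$ be real numbers with $\min\{q_1,q_2\}>0$. Let $u$ and $v$ be positive functions that are differentiable in $\mathbb{R}^n\setminus\{0\}$ and solve the system $$\begin{cases}u(x)=\displaystyle\int_{\mathbb{R}^n}\frac{v^{q_2}(y)}{|x-y|^{n-\gamma}|y|^{\gamma}}\,dy,\\[2mm] v(x)=\displaystyle\int_{\mathbb{R}^n}\frac{u^{q_1}(y)}{|x-y|^{n-\gamma}|x|^{\gamma}}\,dy,\end{cases}\qquad x\in\mathbb{R}^n\setminus\{0\}.$$ Assume that either (i) $(u,v)\in[L^{q_1+1}(\mathbb{R}^n)\cap L^{s}(\mathbb{R}^n)]\times L^{q_2+1}(\mathbb{R}^n)$ for some $s>\frac{nq_1}{\gamma-1}$, or (ii) $(u,v)\in L^{q_1+1}(\mathbb{R}^n)\times[L^{q_2+1}(\mathbb{R}^n)\cap L^{s}(\mathbb{R}^n)]$ for some $s>\frac{nq_2}{\gamma-1}$. Then $q_1q_2=1$. *)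

theory Defs
  imports "HOL-Analysis.Analysis"
begin

text \<open>The exponent \<open>p\<close> may be any positive real, in particular smaller than 1.
  Membership is a property of representatives, not of equivalence classes.\<close>

definition Lp_space :: "real \<Rightarrow> 'a measure \<Rightarrow> ('a \<Rightarrow> real) set" where
  "Lp_space p M = {f \<in> borel_measurable M. integrable M (\<lambda>x. \<bar>f x\<bar> powr p)}"

text \<open>Functions on \<open>\<real>\<^sup>n\<close> minus the origin are total functions with an unconstrained value
  at \<open>0\<close>. The singular points \<open>y = 0\<close> and \<open>y = x\<close> of the integrands, where Isabelle's division
  by zero gives \<open>0\<close>, form a null set. The property \<^const>\<open>has_bochner_integral\<close> includes
  convergence of the integral.\<close>

definition solves_system ::
  "real \<Rightarrow> real \<Rightarrow> real \<Rightarrow> (real ^ 'n \<Rightarrow> real) \<Rightarrow> (real ^ 'n \<Rightarrow> real) \<Rightarrow> bool" where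
  "solves_system \<gamma> q\<^sub>1 q\<^sub>2 u v \<longleftrightarrow>
    (\<forall>x. x \<noteq> 0 \<longrightarrow>
      has_bochner_integral lborel
        (\<lambda>y. v y powr q\<^sub>2 / (norm (x - y) powr (real CARD('n) - \<gamma>) * norm y powr \<gamma>)) (u x) \<and>
      has_bochner_integral lborel
        (\<lambda>y. u y powr q\<^sub>1 / (norm (x - y) powr (real CARD('n) - \<gamma>) * norm x powr \<gamma>)) (v x))"

end

(* Write the system as u = K[v^q2] and v = K^T[u^q1] with a kernel K homogeneous of degree -n.
   For F(c) = int u(x)^q1 u(c x) dx, Tonelli and homogeneity give F(c) = int v(y) v(c y)^q2 dy,
   and by Hoelder F lies below I c^(-n/(q1+1)) and below I c^(-n q2/(q2+1)), where
   I = int u^(q1+1) = int v^(q2+1), with equality at c = 1.  If F is differentiable at 1, the two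
   powers have the same slope there, which is q1 q2 = 1.

   Differentiability under the integral sign needs int int of |x| |x-y|^(gamma-n-1) |y|^(-gamma)
   u(x)^q1 v(y)^q2, which the L^s hypothesis controls only locally.  Hence both dilation identities
   are localised with the cutoff max 0 (1 - |ln |x|| / k), each up to an error O(1/k).  In their sum
   the singular kernels combine with eta(x) x - eta(y) y, a Lipschitz field with a constant
   independent of k, so that k can be sent to infinity using only the finiteness of I.  At
   c = 1 the localised F is squeezed: Young's inequality touches it from above by a smooth
   function, and convexity of r^(-m) bounds its increments from below. *)

theory Submission
  imports Defs
begin

subsection \<open>Integrals and kernels on Euclidean space\<close>

lemma integrable_lborel_scaleR:
  fixes F :: "'a::euclidean_space \<Rightarrow> real"
  assumes "c > 0" and F: "integrable lborel F"
  shows "integrable lborel (\<lambda>x. F (c *\<^sub>R x))"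
    and "(\<integral>x. F (c *\<^sub>R x) \<partial>lborel) = c powr (- real DIM('a)) * (\<integral>x. F x \<partial>lborel)"
proof -
  have [measurable]: "F \<in> borel_measurable borel"
    using F by simp
  have eq: "(lborel :: 'a measure) = density (distr lborel borel (\<lambda>x. c *\<^sub>R x)) (\<lambda>_. ennreal (c ^ DIM('a)))"
    using lborel_affine[of c "0::'a"] \<open>c > 0\<close> by (simp add: ennreal_power)
  have "integrable (density (distr lborel borel (\<lambda>x. c *\<^sub>R x)) (\<lambda>_. ennreal (c ^ DIM('a)))) F"
    using F by (subst (asm) eq)
  then show "integrable lborel (\<lambda>x. F (c *\<^sub>R x))"
    using \<open>c > 0\<close> by (simp add: integrable_density integrable_distr_eq)
  have "(\<integral>x. F x \<partial>lborel) = integral\<^sup>L (density (distr lborel borel (\<lambda>x. c *\<^sub>R x)) (\<lambda>_. ennreal (c ^ DIM('a)))) F"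
    by (subst eq) (rule refl)
  also have "\<dots> = c ^ DIM('a) * (\<integral>x. F (c *\<^sub>R x) \<partial>lborel)"
    using \<open>c > 0\<close> by (simp add: integral_density integral_distr)
  finally show "(\<integral>x. F (c *\<^sub>R x) \<partial>lborel) = c powr (- real DIM('a)) * (\<integral>x. F x \<partial>lborel)"
    using \<open>c > 0\<close> by (simp add: powr_minus powr_realpow)
qed

lemma integrable_lborel_translation:
  fixes F :: "'a::euclidean_space \<Rightarrow> real"
  assumes F: "integrable lborel F"
  shows "integrable lborel (\<lambda>x. F (x - a))"
    and "(\<integral>x. F (x - a) \<partial>lborel) = (\<integral>x. F x \<partial>lborel)"
proof -
  have [measurable]: "F \<in> borel_measurable borel"
    using F by simp
  have eq: "(lborel :: 'a measure) = distr lborel borel (\<lambda>x. x - a)"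
    using lborel_affine[of 1 "- a"] by (simp add: density_1)
  have "integrable (distr lborel borel (\<lambda>x. x - a)) F"
    using F by (subst (asm) eq)
  then show "integrable lborel (\<lambda>x. F (x - a))"
    by (simp add: integrable_distr_eq)
  have "(\<integral>x. F x \<partial>lborel) = integral\<^sup>L (distr lborel borel (\<lambda>x. x - a)) F"
    by (subst eq) (rule refl)
  then show "(\<integral>x. F (x - a) \<partial>lborel) = (\<integral>x. F x \<partial>lborel)"
    by (simp add: integral_distr)
qed

text \<open>Dyadic comparison: with \<open>b \<ge> 0\<close>, on the shell
  \<open>2 powr (- k - 1) < norm z \<le> 2 powr (- k)\<close> the power is at most
  \<open>2 powr (b * (k + 1))\<close>, and the surrounding ball has volume proportional to
  \<open>2 powr (- k * n)\<close>. The resulting series is geometric with ratio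
  \<open>r = 2 powr (b - n) < 1\<close>.\<close>

lemma integrable_norm_powr_cball:
  assumes "0 \<le> b" "b < real DIM('a::euclidean_space)"
  shows "integrable lborel (\<lambda>z::'a. indicator (cball 0 1) z * norm z powr (- b))"
proof (rule integrableI_bounded)
  let ?n = "real DIM('a)"
  let ?V = "unit_ball_vol ?n"
  define r where "r = 2 powr (b - ?n)"
  have r: "0 < r" "r < 1"
    using assms by (auto simp: r_def powr_less_one)
  have term_le: "F k \<le> suminf F" for F :: "nat \<Rightarrow> ennreal" and k
    using sum_le_suminf[of F "{k}"] by simp
  have pt: "ennreal (norm (indicator (cball 0 1) z * norm z powr (- b)))
      \<le> (\<Sum>k. ennreal (2 powr (b * (k + 1))) * indicator (cball 0 (2 powr (- real k))) z)" for z :: 'a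
  proof (cases "z = 0 \<or> norm z > 1")
    case False
    \<comment> \<open>The index of the dyadic shell containing \<open>z\<close>; the single term of
      the series with this index already dominates.\<close>
    define k where "k = nat \<lfloor>- log 2 (norm z)\<rfloor>"
    have nz: "norm z > 0" "norm z \<le> 1" "log 2 (norm z) \<le> 0" using False by auto
    have k: "real k \<le> - log 2 (norm z)" "- log 2 (norm z) < real k + 1"
      using nz(3) unfolding k_def by linarith+
    have "norm z = 2 powr (log 2 (norm z))" using nz by simp
    also have "\<dots> \<le> 2 powr (- real k)" using k by (intro powr_mono) auto
    finally have 1: "norm z \<le> 2 powr (- real k)" .
    have "norm z powr (- b) = 2 powr (- log 2 (norm z) * b)"
      using nz by (simp add: powr_powr[symmetric] powr_minus powr_divide inverse_eq_divide)
    also have "\<dots> \<le> 2 powr (b * (k + 1))"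
      using mult_left_mono[of "- log 2 (norm z)" "real k + 1" b] k assms
      by (intro powr_mono) (auto simp: mult.commute add.commute)
    finally have 2: "norm z powr (- b) \<le> 2 powr (b * (k + 1))" .
    have "ennreal (norm (indicator (cball 0 1) z * norm z powr (- b))) \<le> ennreal (2 powr (b * (k + 1))) * indicator (cball 0 (2 powr (- real k))) z"
      using 1 2 nz by (auto simp: intro!: ennreal_leI)
    also have "\<dots> \<le> (\<Sum>k. ennreal (2 powr (b * (k + 1))) * indicator (cball 0 (2 powr (- real k))) z)"
      by (rule term_le[of "\<lambda>k. ennreal (2 powr (b * real (k + 1))) * indicator (cball 0 (2 powr (- real k))) z" k])
    finally show ?thesis .
  next
    case True
    \<comment> \<open>At the origin this relies on \<open>0 powr (- b) = 0\<close>.\<close>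
    then have "indicator (cball 0 1) z * norm z powr (- b) = 0"
      by (auto simp: indicator_def)
    then show ?thesis by (simp only: norm_zero ennreal_0 zero_le)
  qed
  have "(\<integral>\<^sup>+z. ennreal (norm (indicator (cball 0 1) z * norm (z::'a) powr (- b))) \<partial>lborel)
     \<le> (\<integral>\<^sup>+z. (\<Sum>k. ennreal (2 powr (b * (k + 1))) * indicator (cball 0 (2 powr (- real k))) (z::'a)) \<partial>lborel)"
    by (intro nn_integral_mono pt)
  also have "\<dots> = (\<Sum>k. ennreal (2 powr (b * (k + 1))) * emeasure lborel (cball (0::'a) (2 powr (- real k))))"
    by (rule trans[OF nn_integral_suminf])
      ((rule borel_measurable_times_ennreal borel_measurable_const borel_measurable_indicator borel_closed closed_cball
        | simp only: sets_lborel nn_integral_cmult_indicator borel_closed closed_cball)+)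
  also have "\<dots> = (\<Sum>k. ennreal (2 powr b * ?V * r ^ k))"
  proof (intro suminf_cong)
    fix k :: nat
    have "(2 powr (b * (k + 1))) * (?V * (2 powr (- real k)) ^ DIM('a)) = 2 powr b * ?V * r ^ k"
      by (simp add: r_def powr_realpow[symmetric] powr_powr algebra_simps powr_add powr_diff powr_minus field_simps)
    then show "ennreal (2 powr (b * (k + 1))) * emeasure lborel (cball (0::'a) (2 powr (- real k)))
       = ennreal (2 powr b * ?V * r ^ k)"
      by (subst emeasure_cball, simp, subst ennreal_mult'[symmetric]) (simp_all only: powr_ge_zero)
  qed
  also have "\<dots> < \<infinity>"
  proof -
    have "summable (\<lambda>k. 2 powr b * ?V * r ^ k)"
      using r by (intro summable_mult summable_geometric) auto
    then have "(\<Sum>k. ennreal (2 powr b * ?V * r ^ k)) \<noteq> top"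
      by (rule ennreal_suminf_neq_top) (use r in simp)
    then show ?thesis
      by (simp only: less_top infinity_ennreal_def not_False_eq_True)
  qed
  finally show "(\<integral>\<^sup>+z. ennreal (norm (indicator (cball 0 1) z * norm (z::'a) powr (- b))) \<partial>lborel) < \<infinity>" .
qed (intro borel_measurable_times borel_measurable_indicator powr_real_measurable; simp)

section \<open>Convexity of negative powers and the dilated Riesz kernel\<close>

text \<open>Convexity of \<open>r powr (- m)\<close>: the graph lies above its tangent at
  \<open>b\<close>. With \<open>r = a / b\<close>, the bound \<open>ln r \<le> r - 1\<close> and
  then \<open>1 + z \<le> exp z\<close> at \<open>z = - m * ln r\<close> give it without
  derivatives.\<close>

lemma powr_minus_tangent_le:
  fixes a b m :: real
  assumes "a > 0" "b > 0" "m > 0"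
  shows "b powr (- m) - m * b powr (- m - 1) * (a - b) \<le> a powr (- m)"
proof -
  have "1 - m * (a / b - 1) \<le> 1 - m * ln (a / b)"
    using assms ln_le_minus_one[of "a / b"] by (simp add: mult_left_mono)
  also have "\<dots> \<le> exp (- m * ln (a / b))"
    using exp_ge_add_one_self[of "- m * ln (a / b)"] by simp
  also have "\<dots> = (a / b) powr (- m)"
    using assms by (simp add: powr_def)
  finally have "b powr (- m) * (1 - m * (a / b - 1)) \<le> b powr (- m) * (a / b) powr (- m)"
    by (intro mult_left_mono) auto
  also have "\<dots> = a powr (- m)"
    using assms by (simp add: powr_mult[symmetric])
  finally show ?thesis
    using assms by (simp add: powr_diff field_simps)
qed

text \<open>Only a lower bound, but its error has a majorant that does not depend on \<open>t\<close>; an upper bound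
  would involve the moved singularity \<open>(1 + t) *\<^sub>R x = y\<close>.\<close>
lemma riesz_kernel_dilation_ge:
  fixes x y :: "'a::real_inner"
  assumes m: "m > 0" and ne: "(1 + t) *\<^sub>R x \<noteq> y"
  shows "norm (x - y) powr (- m) - m * t * ((x \<bullet> (x - y)) * norm (x - y) powr (- m - 2))
       - \<bar>t\<bar> * (m * (norm x * norm (x - y) powr (- m - 1)) * min 2 (\<bar>t\<bar> * norm x / (2 * norm (x - y))))
     \<le> norm ((1 + t) *\<^sub>R x - y) powr (- m)"
proof (cases "x = y")
  case False
  define a b where "a = norm ((1 + t) *\<^sub>R x - y)" and "b = norm (x - y)"
  have pos: "a > 0" "b > 0" using ne False by (auto simp: a_def b_def)
  have axy: "(1 + t) *\<^sub>R x - y = (x - y) + t *\<^sub>R x"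
    by (simp add: algebra_simps)
  have sq: "a\<^sup>2 = b\<^sup>2 + 2 * t * (x \<bullet> (x - y)) + t\<^sup>2 * (norm x)\<^sup>2"
    unfolding a_def b_def axy power2_norm_eq_inner inner_add_left inner_add_right
    by (simp add: inner_commute[of "x - y" x] power2_eq_square)
  \<comment> \<open>This linearises the expansion of \<open>a\<^sup>2\<close> from above while
    leaving only \<open>b\<close> in the denominators; \<open>a\<close>, the distance to the moved
    singularity, may be arbitrarily small.\<close>
  have "2 * a * b \<le> a\<^sup>2 + b\<^sup>2"
    by (rule sum_squares_bound)
  then have "2 * b * (a - b) \<le> 2 * t * (x \<bullet> (x - y)) + t\<^sup>2 * (norm x)\<^sup>2"
    using sq by (simp add: algebra_simps power2_eq_square)
  then have e1: "a - b \<le> t * (x \<bullet> (x - y)) / b + \<bar>t\<bar> * norm x * (\<bar>t\<bar> * norm x / (2 * b))"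
    using pos by (simp add: field_simps power2_eq_square)
  \<comment> \<open>The previous bound is second order in \<open>t\<close> but degenerates as
    \<open>b\<close> tends to 0. The triangle inequality gives a cruder bound, linear in
    \<open>t\<close>; together they produce the \<open>min\<close>.\<close>
  have "a \<le> b + \<bar>t\<bar> * norm x"
    unfolding a_def b_def axy using norm_triangle_ineq[of "x - y" "t *\<^sub>R x"] by simp
  moreover have "- (t * (x \<bullet> (x - y)) / b) \<le> \<bar>t\<bar> * norm x"
  proof -
    have "\<bar>t * (x \<bullet> (x - y))\<bar> \<le> \<bar>t\<bar> * (norm x * b)"
      unfolding abs_mult b_def by (intro mult_left_mono Cauchy_Schwarz_ineq2) auto
    then have "\<bar>t * (x \<bullet> (x - y)) / b\<bar> \<le> \<bar>t\<bar> * norm x"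
      using pos by (simp add: field_simps)
    then show ?thesis by linarith
  qed
  ultimately have "a - b \<le> t * (x \<bullet> (x - y)) / b + \<bar>t\<bar> * norm x * 2"
    by linarith
  with e1 have "a - b \<le> t * (x \<bullet> (x - y)) / b + \<bar>t\<bar> * norm x * min 2 (\<bar>t\<bar> * norm x / (2 * b))"
    by (simp add: min_def)
  then have "m * b powr (- m - 1) * (a - b) \<le> m * b powr (- m - 1) *
      (t * (x \<bullet> (x - y)) / b + \<bar>t\<bar> * norm x * min 2 (\<bar>t\<bar> * norm x / (2 * b)))"
    using m by (intro mult_left_mono) auto
  also have "\<dots> = m * t * ((x \<bullet> (x - y)) * (b powr (- m - 1) / b))
      + \<bar>t\<bar> * (m * (norm x * b powr (- m - 1)) * min 2 (\<bar>t\<bar> * norm x / (2 * b)))"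
    by (simp add: distrib_left mult_ac)
  finally have e2: "m * b powr (- m - 1) * (a - b) \<le> m * t * ((x \<bullet> (x - y)) * (b powr (- m - 1) / b))
      + \<bar>t\<bar> * (m * (norm x * b powr (- m - 1)) * min 2 (\<bar>t\<bar> * norm x / (2 * b)))" .
  have "b powr (- m - 1) / b = b powr (- m - 2)"
    using pos by (simp add: powr_diff power2_eq_square field_simps)
  note e3 = e2[unfolded this]
  have gen: "A - D - E \<le> C" if "B \<le> D + E" "A - B \<le> C" for A B C D E :: real
    using that by linarith
  show ?thesis
    using gen[OF e3 powr_minus_tangent_le[OF pos m]] unfolding a_def b_def .
\<comment> \<open>For \<open>x = y\<close> every power on the left is \<open>0 powr _ = 0\<close>,
  so the left side vanishes.\<close>
qed auto

subsection \<open>The logarithmic cutoff\<close>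

text \<open>A cutoff in the variable \<open>ln (norm x)\<close>, with Lipschitz constant
  \<open>1 / k\<close> there: a dilation by \<open>c\<close> changes it by at most
  \<open>\<bar>ln c\<bar> / k\<close>, uniformly in \<open>x \<noteq> 0\<close>. Away from the
  origin it lives on the annulus between the radii \<open>exp (- k)\<close> and
  \<open>exp k\<close>; its value at the origin depends only on the convention for
  \<open>ln 0\<close>.\<close>

definition log_cutoff :: "real \<Rightarrow> 'a::real_normed_vector \<Rightarrow> real" where
  "log_cutoff k x = max 0 (1 - \<bar>ln (norm x)\<bar> / k)"

lemma log_cutoff_nonneg [simp]: "0 \<le> log_cutoff k x"
  and log_cutoff_le_1: "k > 0 \<Longrightarrow> log_cutoff k x \<le> 1"
  by (auto simp: log_cutoff_def)

lemma log_cutoff_measurable [measurable]: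
  "log_cutoff k \<in> borel_measurable (borel :: 'a::real_normed_vector measure)"
  unfolding log_cutoff_def by measurable

lemma abs_log_cutoff_diff_le:
  assumes "k > 0"
  shows "\<bar>log_cutoff k x - log_cutoff k y\<bar> \<le> \<bar>ln (norm x) - ln (norm y)\<bar> / k"
proof -
  have "\<bar>log_cutoff k x - log_cutoff k y\<bar> \<le> \<bar>\<bar>ln (norm x)\<bar> / k - \<bar>ln (norm y)\<bar> / k\<bar>"
    unfolding log_cutoff_def by linarith
  also have "\<dots> = \<bar>\<bar>ln (norm x)\<bar> - \<bar>ln (norm y)\<bar>\<bar> / k"
    using assms by (simp flip: diff_divide_distrib)
  also have "\<dots> \<le> \<bar>ln (norm x) - ln (norm y)\<bar> / k"
    using assms by (intro divide_right_mono) auto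
  finally show ?thesis .
qed

lemma log_cutoff_scaleR_le:
  assumes "k > 0" "c > 0" "x \<noteq> 0"
  shows "log_cutoff k (c *\<^sub>R x) \<le> log_cutoff k x + \<bar>ln c\<bar> / k"
  using abs_log_cutoff_diff_le[OF \<open>k > 0\<close>, of "c *\<^sub>R x" x] assms by (simp add: ln_mult)

text \<open>Between two positive numbers \<open>ln\<close> has slope at most the reciprocal of the
  smaller one. Weighting by the smaller norm therefore gives a Euclidean Lipschitz bound that
  improves as \<open>k\<close> grows.\<close>

lemma log_cutoff_lipschitz:
  assumes "k > 0" "x \<noteq> 0" "y \<noteq> 0"
  shows "\<bar>log_cutoff k x - log_cutoff k y\<bar> * min (norm x) (norm y) \<le> norm (x - y) / k"
proof -
  have *: "\<bar>ln a - ln b\<bar> * min a b \<le> \<bar>a - b\<bar>" if "a > 0" "b > 0" for a b :: real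
  proof -
    have "\<bar>ln a - ln b\<bar> * min a b \<le> \<bar>a - b\<bar>" if "a \<le> b" "a > 0" for a b :: real
    proof -
      have "ln b - ln a \<le> (b - a) / a"
        using that ln_le_minus_one[of "b / a"] by (simp add: ln_div diff_divide_distrib)
      then show ?thesis using that by (simp add: field_simps)
    qed
    from this[of a b] this[of b a] that show ?thesis
      by (cases "a \<le> b") (auto simp: abs_minus_commute min.commute)
  qed
  have "\<bar>log_cutoff k x - log_cutoff k y\<bar> * min (norm x) (norm y)
      \<le> \<bar>ln (norm x) - ln (norm y)\<bar> / k * min (norm x) (norm y)"
    using abs_log_cutoff_diff_le[OF assms(1)] by (intro mult_right_mono) auto
  also have "\<dots> \<le> \<bar>norm x - norm y\<bar> / k"
    using *[of "norm x" "norm y"] assms by (simp add: divide_right_mono)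
  also have "\<dots> \<le> norm (x - y) / k"
    using norm_triangle_ineq3[of x y] assms by (simp add: divide_right_mono)
  finally show ?thesis .
qed

lemma log_cutoff_support:
  assumes "k > 0" "x \<noteq> 0" "log_cutoff k x \<noteq> 0"
  shows "exp (- k) < norm x" "norm x < exp k"
proof -
  have "\<bar>ln (norm x)\<bar> < k"
    using assms by (auto simp: log_cutoff_def max_def field_simps split: if_splits)
  then have "exp (- k) < exp (ln (norm x))" "exp (ln (norm x)) < exp k"
    by auto
  then show "exp (- k) < norm x" "norm x < exp k"
    using assms by auto
qed

lemma log_cutoff_tendsto_1: "(\<lambda>j. log_cutoff (real (Suc j)) x) \<longlonglongrightarrow> 1"
proof -
  have "(\<lambda>j. \<bar>ln (norm x)\<bar> / real (Suc j)) \<longlonglongrightarrow> 0"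
    using lim_const_over_n[of "\<bar>ln (norm x)\<bar>"] by (rule LIMSEQ_Suc)
  then have "(\<lambda>j. max 0 (1 - \<bar>ln (norm x)\<bar> / real (Suc j))) \<longlonglongrightarrow> max 0 (1 - 0)"
    by (intro tendsto_intros)
  then show ?thesis by (simp add: log_cutoff_def)
qed

subsection \<open>Integrability of the differentiated kernel\<close>

text \<open>Where \<open>norm (x - y) \<ge> d\<close>, the extra inverse power costs a factor
  \<open>1 / d\<close> and \<open>fg\<close> suffices. Nearer the diagonal \<open>f\<close> is
  dominated by \<open>h\<close>, and Young's inequality splits
  \<open>h x * norm (x - y) powr (- m - 1)\<close> into \<open>h x powr p\<close> and a locally
  integrable power of \<open>norm (x - y)\<close>. The factor \<open>E\<close> is left abstract so
  that the cutoff may sit on either variable.\<close>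

lemma integrable_singular_kernel:
  fixes f g h :: "'a::euclidean_space \<Rightarrow> real" and E :: "'a \<Rightarrow> 'a \<Rightarrow> real"
  assumes [measurable]: "f \<in> borel_measurable borel" "g \<in> borel_measurable borel"
      "h \<in> borel_measurable borel" "(\<lambda>(x, y). E x y) \<in> borel_measurable (lborel \<Otimes>\<^sub>M lborel)"
    and nonneg: "\<And>x. 0 \<le> f x" "\<And>x. 0 \<le> g x" "\<And>x. 0 \<le> h x" "\<And>x y. 0 \<le> E x y"
    and m: "0 < m" and p: "1 < p" "(m + 1) * p / (p - 1) < real DIM('a)"
    and fg: "integrable (lborel \<Otimes>\<^sub>M lborel) (\<lambda>(x, y). f x * g y * norm (x - y) powr (- m))"
    and g: "integrable lborel (\<lambda>y. g y * (1 + norm y) powr (- m))"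
    and h: "integrable lborel (\<lambda>x. h x powr p)"
    and E: "\<And>x y. E x y \<le> c" and d: "0 < d" "d \<le> 1" and C: "0 \<le> C" "0 \<le> R"
    and fh: "\<And>x. d \<le> norm x \<Longrightarrow> f x \<le> C * h x"
    and supp: "\<And>x y. E x y \<noteq> 0 \<Longrightarrow> norm (x - y) < d \<Longrightarrow> d \<le> norm x \<and> norm y \<le> R"
  shows "integrable (lborel \<Otimes>\<^sub>M lborel) (\<lambda>(x, y). E x y * (f x * g y * norm (x - y) powr (- m - 1)))"
proof -
  \<comment> \<open>The exponent conjugate to \<open>p\<close>; the second assumption on
    \<open>p\<close> says exactly that \<open>norm z powr (- (m + 1) * p')\<close> is integrable
    near 0.\<close>
  define p' where "p' = p / (p - 1)"
  have p': "1 < p'" "1 / p + 1 / p' = 1" "(m + 1) * p' < real DIM('a)" "0 \<le> (m + 1) * p'"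
    using p m by (auto simp: p'_def field_simps)
  define S where "S z = indicator (cball 0 1) z * norm z powr (- ((m + 1) * p'))" for z :: 'a
  define W where "W y = g y * (1 + norm y) powr (- m)" for y
  have S: "integrable lborel S"
    unfolding S_def by (rule integrable_norm_powr_cball[OF p'(4,3)])
  have [measurable]: "S \<in> borel_measurable borel" "W \<in> borel_measurable borel"
    using borel_measurable_integrable[OF S] borel_measurable_integrable[OF g] by (auto simp: W_def[abs_def])
  have S0: "0 \<le> S z" for z by (auto simp: S_def)
  have W0: "0 \<le> W y" for y using nonneg by (auto simp: W_def)
  have c0: "0 \<le> c" using E[of 0 0] nonneg(4)[of 0 0] by linarith
  have intx: "integrable lborel (\<lambda>x. W y * (h x powr p + S (x - y)))" for y
    using h integrable_lborel_translation(1)[OF S] by auto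
  \<comment> \<open>Integrating over \<open>x\<close> first, translation invariance makes the inner
    integral a constant multiple of \<open>W y\<close>.\<close>
  have "integrable (lborel \<Otimes>\<^sub>M lborel) (\<lambda>(y, x). W y * (h x powr p + S (x - y)))"
  proof (rule lborel_pair.Fubini_integrable)
    have "(\<lambda>y. \<integral>x. norm (W y * (h x powr p + S (x - y))) \<partial>lborel)
        = (\<lambda>y. W y * ((\<integral>x. h x powr p \<partial>lborel) + (\<integral>x. S x \<partial>lborel)))"
    proof
      fix y
      have "(\<integral>x. norm (W y * (h x powr p + S (x - y))) \<partial>lborel) = (\<integral>x. W y * (h x powr p + S (x - y)) \<partial>lborel)"
        using W0 S0 by (intro Bochner_Integration.integral_cong) (auto simp: abs_mult)
      also have "\<dots> = W y * ((\<integral>x. h x powr p \<partial>lborel) + (\<integral>x. S (x - y) \<partial>lborel))"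
        using h integrable_lborel_translation(1)[OF S] by simp
      finally show "(\<integral>x. norm (W y * (h x powr p + S (x - y))) \<partial>lborel)
          = W y * ((\<integral>x. h x powr p \<partial>lborel) + (\<integral>x. S x \<partial>lborel))"
        by (simp add: integrable_lborel_translation(2)[OF S])
    qed
    then show "integrable lborel (\<lambda>y. \<integral>x. norm (case (y, x) of (y, x) \<Rightarrow> W y * (h x powr p + S (x - y))) \<partial>lborel)"
      using g by (simp add: W_def)
  qed (use intx in auto)
  then have WS: "integrable (lborel \<Otimes>\<^sub>M lborel) (\<lambda>(x, y). W y * (h x powr p + S (x - y)))"
    by (subst lborel_pair.integrable_product_swap_iff[symmetric]) simp
  have bound: "E x y * (f x * g y * norm (x - y) powr (- m - 1))
      \<le> c / d * (f x * g y * norm (x - y) powr (- m)) + c * C * (1 + R) powr m * (W y * (h x powr p + S (x - y)))"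
    (is "?L \<le> ?A + ?B") for x y
  proof -
    have A0: "0 \<le> ?A" and B0: "0 \<le> ?B"
      using c0 d C nonneg W0 S0 by auto
    consider "E x y = 0" | "x = y" | "d \<le> norm (x - y)" "x \<noteq> y" | "E x y \<noteq> 0" "x \<noteq> y" "norm (x - y) < d"
      by argo
    then show ?thesis
    proof cases
      case 3
      have "norm (x - y) powr (- m - 1) = norm (x - y) powr (- m) / norm (x - y)"
        using 3 by (simp add: powr_diff)
      also have "\<dots> \<le> norm (x - y) powr (- m) / d"
        using 3 d by (intro divide_left_mono) auto
      finally have "?L \<le> c * (f x * g y * (norm (x - y) powr (- m) / d))"
        using E nonneg by (intro mult_mono) (auto intro!: mult_nonneg_nonneg c0)
      also have "\<dots> = ?A" by simp
      finally show ?thesis using B0 by linarith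
    next
      case 4
      then have xy: "d \<le> norm x" "norm y \<le> R" using supp by auto
      \<comment> \<open>On \<open>norm y \<le> R\<close> the weight in \<open>W\<close> is bounded
        below, so \<open>g\<close> is controlled by \<open>W\<close>.\<close>
      have "(1 + norm y) powr m \<le> (1 + R) powr m"
        using xy m by (intro powr_mono2) auto
      then have "1 \<le> (1 + R) powr m * (1 + norm y) powr (- m)"
        using add_pos_nonneg[of 1 "norm y"] by (simp add: powr_minus divide_inverse[symmetric])
      then have gW: "g y \<le> (1 + R) powr m * W y"
        using mult_left_mono[of 1 "(1 + R) powr m * (1 + norm y) powr (- m)" "g y"] nonneg(2)[of y]
        by (simp add: W_def mult_ac)
      have "(- m - 1) * p' = - ((m + 1) * p')"
        by (simp add: algebra_simps)
      then have "(norm (x - y) powr (- m - 1)) powr p' = S (x - y)"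
        using 4 d unfolding S_def powr_powr by simp
      then have "h x * norm (x - y) powr (- m - 1) \<le> h x powr p / p + S (x - y) / p'"
        using Youngs_inequality[OF p(1) p'(1,2) nonneg(3)[of x], of "norm (x - y) powr (- m - 1)"] by simp
      also have "\<dots> \<le> h x powr p + S (x - y)"
        using p(1) p'(1) S0[of "x - y"] mult_right_mono[of 1 p "h x powr p"] mult_right_mono[of 1 p' "S (x - y)"]
        by (intro add_mono) (auto simp: field_simps)
      finally have hS: "h x * norm (x - y) powr (- m - 1) \<le> h x powr p + S (x - y)" .
      have "?L \<le> c * ((C * h x) * ((1 + R) powr m * W y) * norm (x - y) powr (- m - 1))"
        using E fh[OF xy(1)] gW nonneg C W0 by (intro mult_mono mult_nonneg_nonneg c0) auto
      also have "\<dots> = c * C * (1 + R) powr m * (W y * (h x * norm (x - y) powr (- m - 1)))"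
        by (simp add: mult_ac)
      also have "\<dots> \<le> ?B"
        using hS c0 C W0 by (intro mult_left_mono mult_nonneg_nonneg) auto
      finally show ?thesis using A0 by linarith
    qed (use A0 B0 in auto)
  qed
  have "integrable (lborel \<Otimes>\<^sub>M lborel) (\<lambda>(x, y). c / d * (f x * g y * norm (x - y) powr (- m))
      + c * C * (1 + R) powr m * (W y * (h x powr p + S (x - y))))"
    using fg WS by (auto simp: split_beta')
  then show ?thesis
  proof (rule Bochner_Integration.integrable_bound)
    show "(\<lambda>(x, y). E x y * (f x * g y * norm (x - y) powr (- m - 1))) \<in> borel_measurable (lborel \<Otimes>\<^sub>M lborel)"
      unfolding split_beta' by measurable
    show "AE xy in lborel \<Otimes>\<^sub>M lborel. norm (case xy of (x, y) \<Rightarrow> E x y * (f x * g y * norm (x - y) powr (- m - 1)))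
       \<le> norm (case xy of (x, y) \<Rightarrow> c / d * (f x * g y * norm (x - y) powr (- m))
      + c * C * (1 + R) powr m * (W y * (h x powr p + S (x - y))))"
    proof (intro AE_I2, clarify)
      fix x y :: 'a
      have "0 \<le> E x y * (f x * g y * norm (x - y) powr (- m - 1))"
        using nonneg by simp
      with bound[of x y] show "norm (E x y * (f x * g y * norm (x - y) powr (- m - 1)))
       \<le> norm (c / d * (f x * g y * norm (x - y) powr (- m))
      + c * C * (1 + R) powr m * (W y * (h x powr p + S (x - y))))"
        unfolding real_norm_def by linarith
    qed
  qed
qed

text \<open>Higher integrability is available for one factor only, through \<open>h\<close>. The
  second kernel is therefore treated with \<open>f\<close> still in the variable \<open>x\<close>
  and the cutoff placed on \<open>y\<close>; exchanging the variables afterwards gives the stated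
  form. The bound of \<open>f\<close> by \<open>h\<close> is asked for only away from the origin,
  which leaves room for a singular weight in \<open>f\<close>.\<close>

lemma integrable_log_cutoff_kernel:
  fixes f g h :: "'a::euclidean_space \<Rightarrow> real"
  assumes [measurable]: "f \<in> borel_measurable borel" "g \<in> borel_measurable borel"
      "h \<in> borel_measurable borel"
    and nonneg: "\<And>x. 0 \<le> f x" "\<And>x. 0 \<le> g x" "\<And>x. 0 \<le> h x"
    and m: "0 < m" and p: "1 < p" "(m + 1) * p / (p - 1) < real DIM('a)"
    and fg: "integrable (lborel \<Otimes>\<^sub>M lborel) (\<lambda>(x, y). f x * g y * norm (x - y) powr (- m))"
    and g: "integrable lborel (\<lambda>y. g y * (1 + norm y) powr (- m))"
    and h: "integrable lborel (\<lambda>x. h x powr p)"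
    and fh: "\<And>d. 0 < d \<Longrightarrow> \<exists>C\<ge>0. \<forall>x. d \<le> norm x \<longrightarrow> f x \<le> C * h x"
    and k: "k > 0"
  shows "integrable (lborel \<Otimes>\<^sub>M lborel)
      (\<lambda>(x, y). log_cutoff k x * norm x * (f x * g y * norm (x - y) powr (- m - 1)))"
    and "integrable (lborel \<Otimes>\<^sub>M lborel)
      (\<lambda>(x, y). log_cutoff k x * norm x * (g x * f y * norm (x - y) powr (- m - 1)))"
proof -
  \<comment> \<open>Half the inner radius of the annulus: if one point lies in the annulus and the
    other within \<open>d\<close> of it, both have norm at least \<open>d\<close>. As
    \<open>d \<le> 1\<close>, both norms are also at most \<open>exp k + 1\<close>.\<close>
  define d where "d = exp (- k) / 2"
  have "exp (- k) \<le> 1"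
    using k by simp
  then have d: "0 < d" "d \<le> 1"
    unfolding d_def by (simp_all del: exp_le_one_iff)
  obtain C where C: "0 \<le> C" "\<And>x. d \<le> norm x \<Longrightarrow> f x \<le> C * h x"
    using fh[OF d(1)] by blast
  have R: "0 \<le> exp k + 1"
    using exp_gt_zero[of k] by linarith
  \<comment> \<open>The factor \<open>norm w\<close> rules out the origin, where the cutoff itself
    need not vanish.\<close>
  have supp: "exp (- k) < norm w \<and> norm w < exp k" if "log_cutoff k w * norm w \<noteq> 0" for w :: 'a
    using log_cutoff_support[OF k, of w] that by auto
  have le: "log_cutoff k w * norm w \<le> exp k" for w :: 'a
  proof (cases "log_cutoff k w * norm w = 0")
    case False
    then show ?thesis
      using mult_mono[OF log_cutoff_le_1[OF k, of w] less_imp_le[OF conjunct2[OF supp]]] by simp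
  next
    case True
    show ?thesis unfolding True by simp
  qed
  have tri: "norm x \<le> norm y + norm (x - y)" "norm y \<le> norm x + norm (x - y)" for x y :: 'a
    using norm_triangle_ineq3[of x y] by linarith+
  show "integrable (lborel \<Otimes>\<^sub>M lborel)
      (\<lambda>(x, y). log_cutoff k x * norm x * (f x * g y * norm (x - y) powr (- m - 1)))"
  proof (rule integrable_singular_kernel[OF _ _ _ _ nonneg _ m p fg g h le d C(1) R C(2)])
    fix x y :: 'a
    assume "log_cutoff k x * norm x \<noteq> 0" "norm (x - y) < d"
    then show "d \<le> norm x \<and> norm y \<le> exp k + 1"
      using supp[of x] tri(2)[of y x] tri(1)[of x y] d exp_gt_zero[of "- k"] by (auto simp: d_def norm_minus_commute)
  qed (auto intro!: mult_nonneg_nonneg log_cutoff_nonneg)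
  have "integrable (lborel \<Otimes>\<^sub>M lborel)
      (\<lambda>(x, y). log_cutoff k y * norm y * (f x * g y * norm (x - y) powr (- m - 1)))"
  proof (rule integrable_singular_kernel[OF _ _ _ _ nonneg _ m p fg g h le d C(1) R C(2)])
    fix x y :: 'a
    assume "log_cutoff k y * norm y \<noteq> 0" "norm (x - y) < d"
    then show "d \<le> norm x \<and> norm y \<le> exp k + 1"
      using supp[of y] tri(1)[of y x] tri(2)[of x y] d exp_gt_zero[of "- k"] by (auto simp: d_def norm_minus_commute)
  qed (auto intro!: mult_nonneg_nonneg log_cutoff_nonneg)
  from lborel_pair.integrable_product_swap[OF this]
  show "integrable (lborel \<Otimes>\<^sub>M lborel)
      (\<lambda>(x, y). log_cutoff k x * norm x * (g x * f y * norm (x - y) powr (- m - 1)))"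
    by (simp add: norm_minus_commute mult_ac)
qed

section \<open>From one-sided increments to inequalities between slopes\<close>

text \<open>Divide the increment bound by \<open>t\<close> and let \<open>t\<close> tend to 0. As
  \<open>R\<close> is differentiable, a sequence suffices; \<open>1 / (j + 3)\<close> stays strictly
  below \<open>1 / 2\<close>. The sign \<open>s\<close> selects the side of 0, and using both signs
  bounds \<open>D + a\<close> from both sides.\<close>

lemma one_sided_derivative_bound:
  fixes R e :: "real \<Rightarrow> real"
  assumes R: "(R has_real_derivative D) (at 0)" and s: "\<bar>s\<bar> = 1"
    and e: "(\<lambda>j. e (1 / real (j + 3))) \<longlonglongrightarrow> 0"
    and le: "\<And>t. 0 < t \<Longrightarrow> t < 1 / 2 \<Longrightarrow> - (s * t) * a - t * e t \<le> R (s * t) - R 0"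
  shows "0 \<le> s * (D + a)"
proof -
  define t where "t j = 1 / real (j + 3)" for j :: nat
  have t: "0 < t j" "t j < 1 / 2" for j
    by (auto simp: t_def field_simps)
  have t0: "t \<longlonglongrightarrow> 0"
    unfolding t_def using LIMSEQ_ignore_initial_segment[OF lim_const_over_n[of 1], of 3] by simp
  have s0: "s \<noteq> 0" "s * s = 1"
    using s by (auto simp: abs_if split: if_splits)
  have "filterlim (\<lambda>j. s * t j) (at 0) sequentially"
    using s0 t(1) t0 by (intro filterlim_atI tendsto_mult_right_zero) (auto simp: less_imp_neq[OF t(1), symmetric])
  then have "(\<lambda>j. (R (s * t j) - R 0) / (s * t j)) \<longlonglongrightarrow> D"
    using R unfolding has_field_derivative_iff by (auto intro: filterlim_compose)
  then have "(\<lambda>j. s * ((R (s * t j) - R 0) / (s * t j)) + e (t j)) \<longlonglongrightarrow> s * D + 0"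
    using e unfolding t_def by (intro tendsto_intros)
  moreover have "- s * a \<le> s * ((R (s * t j) - R 0) / (s * t j)) + e (t j)" for j
  proof -
    have "- (s * t j) * a - t j * e (t j) \<le> t j * (s * ((R (s * t j) - R 0) / (s * t j)))"
      using le[OF t, of j] s0 t(1)[of j] by simp
    then have "t j * (- s * a) \<le> t j * (s * ((R (s * t j) - R 0) / (s * t j)) + e (t j))"
      by (simp add: algebra_simps)
    then show ?thesis
      using t(1)[of j] by (simp only: mult_le_cancel_left_pos)
  qed
  ultimately have "- s * a \<le> s * D + 0"
    by (intro LIMSEQ_le_const) auto
  then show ?thesis by (simp add: algebra_simps)
qed

subsection \<open>Dilation of localised energies\<close>

lemma AE_pair_scaleR_neq: "AE (x, y) in lborel \<Otimes>\<^sub>M lborel. c *\<^sub>R x \<noteq> (y :: 'a::euclidean_space)"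
proof (rule lborel_pair.AE_pair_measure)
  show "{p \<in> space (lborel \<Otimes>\<^sub>M lborel). case p of (x, y) \<Rightarrow> c *\<^sub>R x \<noteq> (y :: 'a)} \<in> sets (lborel \<Otimes>\<^sub>M lborel)"
    unfolding split_beta' by measurable
  have "AE y in lborel. c *\<^sub>R x \<noteq> y" for x :: 'a
    using AE_lborel_singleton[of "c *\<^sub>R x"] by eventually_elim auto
  then show "AE x in lborel. AE y in lborel. case (x, y) of (x, y) \<Rightarrow> c *\<^sub>R x \<noteq> (y :: 'a)"
    by simp
qed

text \<open>Integrates the convexity bound for the dilated kernel against \<open>f x * g y\<close>.
  Here \<open>- m * X\<close> is the formal derivative of \<open>G\<close> at 0, and
  \<open>t * e t\<close> is the integrated error, for which \<open>e\<close> tends to 0 by dominated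
  convergence with the majorant supplied by \<open>J\<close>.\<close>

lemma riesz_energy_dilation_ge:
  fixes f g :: "'a::euclidean_space \<Rightarrow> real" and m :: real
  defines "G t \<equiv> (\<integral>(x, y). f x * g y * norm ((1 + t) *\<^sub>R x - y) powr (- m) \<partial>(lborel \<Otimes>\<^sub>M lborel))"
    and "X \<equiv> (\<integral>(x, y). f x * g y * ((x \<bullet> (x - y)) * norm (x - y) powr (- m - 2)) \<partial>(lborel \<Otimes>\<^sub>M lborel))"
  assumes [measurable]: "f \<in> borel_measurable borel" "g \<in> borel_measurable borel"
    and nonneg: "\<And>x. 0 \<le> f x" "\<And>x. 0 \<le> g x" and m: "0 < m"
    and J: "integrable (lborel \<Otimes>\<^sub>M lborel) (\<lambda>(x, y). norm x * (f x * g y * norm (x - y) powr (- m - 1)))"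
    and G: "\<And>t. \<bar>t\<bar> < 1 / 2 \<Longrightarrow>
      integrable (lborel \<Otimes>\<^sub>M lborel) (\<lambda>(x, y). f x * g y * norm ((1 + t) *\<^sub>R x - y) powr (- m))"
  shows "integrable (lborel \<Otimes>\<^sub>M lborel) (\<lambda>(x, y). f x * g y * ((x \<bullet> (x - y)) * norm (x - y) powr (- m - 2)))"
    and "\<exists>e. (\<lambda>j. e (1 / real (j + 3))) \<longlonglongrightarrow> 0 \<and>
      (\<forall>s t. \<bar>s\<bar> = 1 \<longrightarrow> 0 < t \<longrightarrow> t < 1 / 2 \<longrightarrow> - (s * t) * (m * X) - t * e t \<le> G (s * t) - G 0)"
proof -
  let ?M = "lborel \<Otimes>\<^sub>M lborel :: ('a \<times> 'a) measure"
  define Xi where "Xi = (\<lambda>(x, y). f x * g y * ((x \<bullet> (x - y)) * norm (x - y) powr (- m - 2)))"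
  define Ji where "Ji = (\<lambda>(x, y). norm x * (f x * g y * norm (x - y) powr (- m - 1)))"
  \<comment> \<open>The error of the convexity bound divided by \<open>t\<close>. It depends only on
    the size of the dilation parameter, so one \<open>e\<close> serves both signs
    \<open>s\<close>.\<close>
  define Ei where "Ei t = (\<lambda>(x, y). m * Ji (x, y) * min 2 (t * norm x / (2 * norm (x - y))))" for t
  define Gi where "Gi t = (\<lambda>(x, y). f x * g y * norm ((1 + t) *\<^sub>R x - y) powr (- m))" for t
  define e where "e t = (\<integral>p. Ei t p \<partial>?M)" for t
  have [measurable]: "Xi \<in> borel_measurable ?M" "Ji \<in> borel_measurable ?M" "Ei t \<in> borel_measurable ?M" for t
    unfolding Xi_def Ji_def Ei_def split_beta' by measurable
  have Ji: "integrable ?M Ji" and Ji0: "0 \<le> Ji p" for p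
    using J nonneg by (auto simp: Ji_def split: prod.splits)
  have Xi: "integrable ?M Xi"
  proof (rule Bochner_Integration.integrable_bound[OF Ji])
    show "AE p in ?M. norm (Xi p) \<le> norm (Ji p)"
    proof (intro AE_I2, clarify)
      fix x y :: 'a
      have exponent: "1 + (- m - 2) = - m - 1"
        by simp
      have *: "\<bar>x \<bullet> (x - y)\<bar> * norm (x - y) powr (- m - 2) \<le> norm x * norm (x - y) powr (- m - 1)"
      proof (cases "x = y")
        case False
        have "\<bar>x \<bullet> (x - y)\<bar> * norm (x - y) powr (- m - 2) \<le> (norm x * norm (x - y)) * norm (x - y) powr (- m - 2)"
          by (intro mult_right_mono Cauchy_Schwarz_ineq2) auto
        also have "\<dots> = norm x * norm (x - y) powr (- m - 1)"
          using powr_mult_base[of "norm (x - y)" "- m - 2"] exponent by (simp only: mult.assoc norm_ge_zero)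
        finally show ?thesis .
      qed simp
      have "norm (Xi (x, y)) = f x * g y * (\<bar>x \<bullet> (x - y)\<bar> * norm (x - y) powr (- m - 2))"
        using nonneg by (simp add: Xi_def abs_mult)
      also have "\<dots> \<le> f x * g y * (norm x * norm (x - y) powr (- m - 1))"
        using nonneg * by (intro mult_left_mono) auto
      also have "\<dots> = norm (Ji (x, y))"
        using nonneg by (simp add: Ji_def mult_ac)
      finally show "norm (Xi (x, y)) \<le> norm (Ji (x, y))" .
    qed
  qed simp
  then show "integrable ?M (\<lambda>(x, y). f x * g y * ((x \<bullet> (x - y)) * norm (x - y) powr (- m - 2)))"
    by (simp add: Xi_def)
  have Ei_bound: "norm (Ei t p) \<le> 2 * m * Ji p" if "0 < t" for t p
  proof (cases p)
    case (Pair x y)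
    have "0 \<le> min 2 (t * norm x / (2 * norm (x - y)))" "min 2 (t * norm x / (2 * norm (x - y))) \<le> 2"
      using that by auto
    then show ?thesis
      using mult_left_mono[of "min 2 (t * norm x / (2 * norm (x - y)))" 2 "m * Ji p"] m Ji0[of p]
      unfolding Pair Ei_def by (simp add: abs_mult)
  qed
  have Ei: "integrable ?M (Ei t)" if "0 < t" for t
    by (rule Bochner_Integration.integrable_bound[of _ "\<lambda>p. 2 * m * Ji p"])
      (use Ji Ji0 m Ei_bound[OF that] in \<open>auto simp: abs_mult\<close>)
  have "(\<lambda>j. \<integral>p. Ei (1 / real (j + 3)) p \<partial>?M) \<longlonglongrightarrow> (\<integral>p. 0 \<partial>?M)"
  proof (rule integral_dominated_convergence[where w = "\<lambda>p. 2 * m * Ji p"])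
    show "AE p in ?M. (\<lambda>j. Ei (1 / real (j + 3)) p) \<longlonglongrightarrow> 0"
    proof (intro AE_I2, clarify)
      fix x y :: 'a
      have "(\<lambda>j. 1 / real (j + 3)) \<longlonglongrightarrow> 0"
        using LIMSEQ_ignore_initial_segment[OF lim_const_over_n[of 1], of 3] by simp
      then have "(\<lambda>j. m * Ji (x, y) * min 2 (1 / real (j + 3) * norm x / (2 * norm (x - y))))
          \<longlonglongrightarrow> m * Ji (x, y) * min 2 (0 * norm x * inverse (2 * norm (x - y)))"
        \<comment> \<open>As a product with a fixed inverse the quotient has the limit 0 also for
          \<open>x = y\<close>, where the denominator is 0.\<close>
        unfolding divide_inverse[of _ "2 * norm (x - y)"] by (intro tendsto_intros)
      then show "(\<lambda>j. Ei (1 / real (j + 3)) (x, y)) \<longlonglongrightarrow> 0"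
        by (simp add: Ei_def)
    qed
  qed (use Ji Ei_bound in auto)
  then have e0: "(\<lambda>j. e (1 / real (j + 3))) \<longlonglongrightarrow> 0"
    by (simp add: e_def)
  moreover have "- (s * t) * (m * X) - t * e t \<le> G (s * t) - G 0"
    if s: "\<bar>s\<bar> = 1" and t: "0 < t" "t < 1 / 2" for s t
  proof -
    have st: "\<bar>s * t\<bar> = t" "\<bar>s * t\<bar> < 1 / 2"
      using s t by (auto simp: abs_mult)
    have Gi: "integrable ?M (Gi (s * t))" "integrable ?M (Gi 0)"
      using G[OF st(2)] G[of 0] by (auto simp: Gi_def)
    have "(\<integral>p. Gi 0 p - m * (s * t) * Xi p - t * Ei t p \<partial>?M) \<le> (\<integral>p. Gi (s * t) p \<partial>?M)"
    proof (rule integral_mono_AE)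
      show "AE p in ?M. Gi 0 p - m * (s * t) * Xi p - t * Ei t p \<le> Gi (s * t) p"
        using AE_pair_scaleR_neq[of "1 + s * t"]
      proof eventually_elim
        case (elim p)
        obtain x y where p: "p = (x, y)" by force
        have "f x * g y * (norm (x - y) powr (- m) - m * (s * t) * ((x \<bullet> (x - y)) * norm (x - y) powr (- m - 2))
            - \<bar>s * t\<bar> * (m * (norm x * norm (x - y) powr (- m - 1)) * min 2 (\<bar>s * t\<bar> * norm x / (2 * norm (x - y)))))
          \<le> f x * g y * norm ((1 + s * t) *\<^sub>R x - y) powr (- m)"
          using elim nonneg by (intro mult_left_mono riesz_kernel_dilation_ge m mult_nonneg_nonneg) (auto simp: p)
        then show ?case
          unfolding p Gi_def Xi_def Ei_def Ji_def prod.case st(1) by (simp add: right_diff_distrib mult_ac)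
      qed
    qed (use Gi Xi Ei[OF t(1)] in auto)
    moreover have "(\<integral>p. Gi 0 p - m * (s * t) * Xi p - t * Ei t p \<partial>?M) = G 0 - m * (s * t) * X - t * e t"
      using Gi Xi Ei[OF t(1)] by (simp add: G_def X_def e_def Gi_def Xi_def)
    ultimately show ?thesis
      by (simp add: G_def Gi_def mult_ac)
  qed
  ultimately show "\<exists>e. (\<lambda>j. e (1 / real (j + 3))) \<longlonglongrightarrow> 0 \<and>
      (\<forall>s t. \<bar>s\<bar> = 1 \<longrightarrow> 0 < t \<longrightarrow> t < 1 / 2 \<longrightarrow> - (s * t) * (m * X) - t * e t \<le> G (s * t) - G 0)"
    by blast
qed

section \<open>Upper bounds for the dilated energies\<close>

text \<open>The substitution \<open>x \<mapsto> x / c\<close> moves the dilation from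
  \<open>F\<close> to the cutoff, whose variation is at most \<open>\<bar>ln c\<bar> / k\<close>.
  This is the source of the O(1/k) error in the localised identities.\<close>

lemma integral_log_cutoff_dilation_le:
  fixes F :: "'a::euclidean_space \<Rightarrow> real"
  assumes F: "integrable lborel F" "\<And>x. 0 \<le> F x" and k: "k > 0" and c: "c > 0"
  shows "integrable lborel (\<lambda>x. log_cutoff k x * F (c *\<^sub>R x))"
    and "(\<integral>x. log_cutoff k x * F (c *\<^sub>R x) \<partial>lborel)
      \<le> c powr (- real DIM('a)) * ((\<integral>x. log_cutoff k x * F x \<partial>lborel) + \<bar>ln c\<bar> / k * (\<integral>x. F x \<partial>lborel))"
proof -
  have [measurable]: "F \<in> borel_measurable borel"
    using F by simp
  have int: "integrable lborel (\<lambda>x. log_cutoff k (d *\<^sub>R x) * F x)" for d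
    by (rule Bochner_Integration.integrable_bound[OF F(1)])
      (auto simp: abs_mult F(2) k intro!: AE_I2 mult_left_le_one_le log_cutoff_le_1)
  have eq: "(\<lambda>x. log_cutoff k ((1 / c) *\<^sub>R (c *\<^sub>R x)) * F (c *\<^sub>R x)) = (\<lambda>x. log_cutoff k x * F (c *\<^sub>R x))"
    using c by simp
  note sc = integrable_lborel_scaleR[OF c int[of "1 / c"], unfolded eq]
  show "integrable lborel (\<lambda>x. log_cutoff k x * F (c *\<^sub>R x))"
    by (rule sc(1))
  have "(\<integral>x. log_cutoff k ((1 / c) *\<^sub>R x) * F x \<partial>lborel)
      \<le> (\<integral>x. log_cutoff k x * F x + \<bar>ln c\<bar> / k * F x \<partial>lborel)"
  proof (rule integral_mono_AE)
    show "AE x in lborel. log_cutoff k ((1 / c) *\<^sub>R x) * F x \<le> log_cutoff k x * F x + \<bar>ln c\<bar> / k * F x"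
      using AE_lborel_singleton[of 0]
    proof eventually_elim
      case (elim x)
      then show ?case
        using mult_right_mono[OF log_cutoff_scaleR_le[OF k, of "1 / c" x] F(2)[of x]] c
        by (simp add: ln_div distrib_right)
    qed
  qed (use int[of "1 / c"] int[of 1] F in auto)
  also have "\<dots> = (\<integral>x. log_cutoff k x * F x \<partial>lborel) + \<bar>ln c\<bar> / k * (\<integral>x. F x \<partial>lborel)"
    using int[of 1] F by simp
  finally show "(\<integral>x. log_cutoff k x * F (c *\<^sub>R x) \<partial>lborel)
      \<le> c powr (- real DIM('a)) * ((\<integral>x. log_cutoff k x * F x \<partial>lborel) + \<bar>ln c\<bar> / k * (\<integral>x. F x \<partial>lborel))"
    unfolding sc(2) by (intro mult_left_mono) auto
qed

text \<open>Young's inequality with exponents \<open>(q + 1) / q\<close> and \<open>q + 1\<close>.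
  It is an equality for \<open>a = b\<close>, so the upper bound built from it touches the energy at
  the undilated point.\<close>

lemma powr_mult_le_convex:
  fixes a b q :: real
  assumes "a > 0" "b > 0" "q > 0"
  shows "a powr q * b \<le> q / (q + 1) * a powr (q + 1) + 1 / (q + 1) * b powr (q + 1)"
  using Youngs_inequality_0[of "q / (q + 1)" "1 / (q + 1)" "a powr (q + 1)" "b powr (q + 1)"] assms
  by (simp add: powr_powr add_divide_distrib[symmetric])

text \<open>Dilate one variable in the energy with density
  \<open>log_cutoff k x * f x * g y\<close>. By the integral equation its value is the integral of
  \<open>U t\<close>, which Young's inequality bounds above by an explicit differentiable function
  agreeing with the energy at \<open>t = 0\<close>. The convexity bound gives increments from below
  with slope \<open>- m * X\<close>. Comparing slopes on both sides of 0 yields the identity up to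
  the cutoff error.\<close>

lemma local_pohozaev:
  fixes w f g :: "'a::euclidean_space \<Rightarrow> real" and m q b k :: real
  defines "A \<equiv> (\<integral>x. log_cutoff k x * w x powr (q + 1) \<partial>lborel)"
    and "I \<equiv> (\<integral>x. w x powr (q + 1) \<partial>lborel)"
    and "X \<equiv> (\<integral>(x, y). log_cutoff k x * f x * g y * ((x \<bullet> (x - y)) * norm (x - y) powr (- m - 2)) \<partial>(lborel \<Otimes>\<^sub>M lborel))"
  assumes [measurable]: "w \<in> borel_measurable borel" "f \<in> borel_measurable borel" "g \<in> borel_measurable borel"
    and pos: "0 < m" "0 < q" "0 < k"
    and w: "\<And>x. x \<noteq> 0 \<Longrightarrow> 0 < w x" and f0: "\<And>x. 0 \<le> f x" and g: "\<And>x. 0 \<le> g x"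
    and f: "\<And>x. x \<noteq> 0 \<Longrightarrow> f x = w x powr q * norm x powr (- b)"
    and wint: "integrable lborel (\<lambda>x. w x powr (q + 1))"
    and sol: "\<And>x. x \<noteq> 0 \<Longrightarrow>
      has_bochner_integral lborel (\<lambda>y. g y * norm (x - y) powr (- m)) (norm x powr b * w x)"
    and J: "integrable (lborel \<Otimes>\<^sub>M lborel)
      (\<lambda>(x, y). log_cutoff k x * norm x * (f x * g y * norm (x - y) powr (- m - 1)))"
  shows "integrable (lborel \<Otimes>\<^sub>M lborel)
      (\<lambda>(x, y). log_cutoff k x * f x * g y * ((x \<bullet> (x - y)) * norm (x - y) powr (- m - 2)))"
    and "\<bar>m * X + b * A - real DIM('a) * A / (q + 1)\<bar> \<le> I / (k * (q + 1))"
proof -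
  let ?M = "lborel \<Otimes>\<^sub>M lborel :: ('a \<times> 'a) measure"
  let ?n = "real DIM('a)"
  define Gi where "Gi t = (\<lambda>(x, y). log_cutoff k x * f x * g y * norm ((1 + t) *\<^sub>R x - y) powr (- m))" for t
  \<comment> \<open>The inner integral over \<open>y\<close>, evaluated by the equation for
    \<open>w\<close> at the point \<open>(1 + t) *\<^sub>R x\<close>; the weights
    \<open>norm x powr b\<close> cancel up to \<open>(1 + t) powr b\<close>.\<close>
  define U where "U t x = (1 + t) powr b * (log_cutoff k x * (w x powr q * w ((1 + t) *\<^sub>R x)))" for t x
  have [measurable]: "Gi t \<in> borel_measurable ?M" "U t \<in> borel_measurable borel" for t
    unfolding Gi_def U_def[abs_def] split_beta' by measurable
  have Gi0: "0 \<le> Gi t p" for t p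
    using f0 g log_cutoff_nonneg by (auto simp: Gi_def split: prod.splits)
  have A_int: "integrable lborel (\<lambda>x. log_cutoff k x * w x powr (q + 1))"
    using integral_log_cutoff_dilation_le(1)[OF wint _ pos(3), of 1] by simp
  have inner: "has_bochner_integral lborel (\<lambda>y. Gi t (x, y)) (U t x)" if "x \<noteq> 0" "\<bar>t\<bar> < 1 / 2" for t x
  proof -
    have ne: "(1 + t) *\<^sub>R x \<noteq> 0" and t: "0 < 1 + t"
      using that by auto
    have "norm x powr (- b) * (norm ((1 + t) *\<^sub>R x) powr b) = (1 + t) powr b"
      using that(1) t by (simp add: powr_mult powr_minus)
    then have "log_cutoff k x * f x * (norm ((1 + t) *\<^sub>R x) powr b * w ((1 + t) *\<^sub>R x)) = U t x"
      unfolding f[OF that(1)] U_def by (simp add: mult_ac)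
    then show ?thesis
      using has_bochner_integral_mult_right[OF sol[OF ne], of "log_cutoff k x * f x"]
      by (simp add: Gi_def mult_ac)
  qed
  have U: "integrable lborel (U t)"
      "(\<integral>x. U t x \<partial>lborel) \<le> (1 + t) powr b * (q / (q + 1) * A + (1 + t) powr (- ?n) * (A + \<bar>ln (1 + t)\<bar> / k * I) / (q + 1))"
    if "\<bar>t\<bar> < 1 / 2" for t
  proof -
    have t: "0 < 1 + t"
      using that by auto
    define V where "V x = (1 + t) powr b * (q / (q + 1) * (log_cutoff k x * w x powr (q + 1))
      + 1 / (q + 1) * (log_cutoff k x * w ((1 + t) *\<^sub>R x) powr (q + 1)))" for x
    note dil = integral_log_cutoff_dilation_le[OF wint _ pos(3) t]
    have V: "integrable lborel V"
      unfolding V_def[abs_def] using A_int dil(1) by auto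
    have "AE x in lborel. U t x \<le> V x \<and> 0 \<le> U t x"
      using AE_lborel_singleton[of 0]
    proof eventually_elim
      case (elim x)
      then have "0 < w x" "0 < w ((1 + t) *\<^sub>R x)"
        using w t by auto
      then have "(1 + t) powr b * (log_cutoff k x * (w x powr q * w ((1 + t) *\<^sub>R x)))
          \<le> (1 + t) powr b * (log_cutoff k x * (q / (q + 1) * w x powr (q + 1) + 1 / (q + 1) * w ((1 + t) *\<^sub>R x) powr (q + 1)))"
        using pos by (intro mult_left_mono powr_mult_le_convex log_cutoff_nonneg) auto
      moreover have "0 \<le> U t x"
        unfolding U_def using \<open>0 < w ((1 + t) *\<^sub>R x)\<close> by (intro mult_nonneg_nonneg log_cutoff_nonneg) auto
      ultimately show ?case
        by (simp add: U_def V_def algebra_simps)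
    qed
    then have UV: "AE x in lborel. U t x \<le> V x" and U0: "AE x in lborel. 0 \<le> U t x"
      by auto
    show int: "integrable lborel (U t)"
      by (rule Bochner_Integration.integrable_bound[OF V]) (use UV U0 in auto)
    have "(\<integral>x. U t x \<partial>lborel) \<le> (\<integral>x. V x \<partial>lborel)"
      by (rule integral_mono_AE[OF int V UV])
    also have "\<dots> = (1 + t) powr b * (q / (q + 1) * A + 1 / (q + 1) * (\<integral>x. log_cutoff k x * w ((1 + t) *\<^sub>R x) powr (q + 1) \<partial>lborel))"
      unfolding V_def[abs_def] A_def using A_int dil(1) by simp
    also have "\<dots> \<le> (1 + t) powr b * (q / (q + 1) * A + 1 / (q + 1) * ((1 + t) powr (- ?n) * (A + \<bar>ln (1 + t)\<bar> / k * I)))"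
      using dil(2) pos unfolding A_def I_def by (intro mult_left_mono add_left_mono) auto
    finally show "(\<integral>x. U t x \<partial>lborel) \<le> (1 + t) powr b * (q / (q + 1) * A + (1 + t) powr (- ?n) * (A + \<bar>ln (1 + t)\<bar> / k * I) / (q + 1))"
      by simp
  qed
  have inner_AE: "AE x in lborel. has_bochner_integral lborel (\<lambda>y. Gi t (x, y)) (U t x)" if "\<bar>t\<bar> < 1 / 2" for t
    using AE_lborel_singleton[of 0] by eventually_elim (use inner that in auto)
  have Gi: "integrable ?M (Gi t)" "(\<integral>p. Gi t p \<partial>?M) = (\<integral>x. U t x \<partial>lborel)" if "\<bar>t\<bar> < 1 / 2" for t
  proof -
    have inner': "AE x in lborel. (\<integral>y. Gi t (x, y) \<partial>lborel) = U t x"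
      using inner_AE[OF that] by eventually_elim (simp add: has_bochner_integral_iff)
    show int: "integrable ?M (Gi t)"
    proof (rule lborel_pair.Fubini_integrable)
      have "integrable lborel (\<lambda>x. \<integral>y. Gi t (x, y) \<partial>lborel)"
        using U(1)[OF that] by (rule integrable_cong_AE[THEN iffD2, rotated -1]) (use inner' in auto)
      then show "integrable lborel (\<lambda>x. \<integral>y. norm (Gi t (x, y)) \<partial>lborel)"
        using Gi0 by simp
      show "AE x in lborel. integrable lborel (\<lambda>y. Gi t (x, y))"
        using inner_AE[OF that] by eventually_elim (simp add: has_bochner_integral_iff)
    qed simp
    have "(\<integral>p. Gi t p \<partial>?M) = (\<integral>x. \<integral>y. Gi t (x, y) \<partial>lborel \<partial>lborel)"
      by (rule lborel_pair.integral_fst'[OF int, symmetric])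
    also have "\<dots> = (\<integral>x. U t x \<partial>lborel)"
      by (rule integral_cong_AE) (use inner' in auto)
    finally show "(\<integral>p. Gi t p \<partial>?M) = (\<integral>x. U t x \<partial>lborel)" .
  qed
  have U0: "(\<integral>x. U 0 x \<partial>lborel) = A"
    unfolding A_def
  proof (rule integral_cong_AE)
    show "AE x in lborel. U 0 x = log_cutoff k x * w x powr (q + 1)"
      using AE_lborel_singleton[of 0]
    proof eventually_elim
      case (elim x)
      then show ?case
        using w[of x] by (simp add: U_def powr_add)
    qed
  qed auto
  have J': "integrable ?M (\<lambda>(x, y). norm x * (log_cutoff k x * f x * g y * norm (x - y) powr (- m - 1)))"
    using J by (simp add: mult_ac)
  have low: "integrable ?M (\<lambda>(x, y). log_cutoff k x * f x * g y * ((x \<bullet> (x - y)) * norm (x - y) powr (- m - 2)))"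
    "\<exists>e. (\<lambda>j. e (1 / real (j + 3))) \<longlonglongrightarrow> 0 \<and> (\<forall>s t. \<bar>s\<bar> = 1 \<longrightarrow> 0 < t \<longrightarrow> t < 1 / 2 \<longrightarrow>
        - (s * t) * (m * X) - t * e t \<le> (\<integral>p. Gi (s * t) p \<partial>?M) - (\<integral>p. Gi 0 p \<partial>?M))"
    using riesz_energy_dilation_ge[of "\<lambda>x. log_cutoff k x * f x" g m] J' Gi(1) f0 g pos log_cutoff_nonneg
    unfolding X_def Gi_def by (auto simp: mult_nonneg_nonneg)
  show "integrable ?M (\<lambda>(x, y). log_cutoff k x * f x * g y * ((x \<bullet> (x - y)) * norm (x - y) powr (- m - 2)))"
    by (rule low(1))
  obtain e where e: "(\<lambda>j. e (1 / real (j + 3))) \<longlonglongrightarrow> 0"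
    "\<And>s t. \<bar>s\<bar> = 1 \<Longrightarrow> 0 < t \<Longrightarrow> t < 1 / 2 \<Longrightarrow>
        - (s * t) * (m * X) - t * e t \<le> (\<integral>p. Gi (s * t) p \<partial>?M) - (\<integral>p. Gi 0 p \<partial>?M)"
    using low(2) by blast
  have qA: "q / (q + 1) * A = A - A / (q + 1)"
    using pos by (simp add: field_simps)
  \<comment> \<open>The upper bound from \<open>U\<close>, with
    \<open>\<bar>ln (1 + t)\<bar>\<close> replaced by \<open>s * ln (1 + t)\<close>. The two agree
    on the side of 0 selected by \<open>s\<close>, and the new expression is differentiable at
    0.\<close>
  define R where "R s t = (1 + t) powr b * (A - A / (q + 1) + (1 + t) powr (- ?n) * (A + s * ln (1 + t) / k * I) / (q + 1))"
    for s t :: real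
  have R0: "R s 0 = A" for s
    by (simp add: R_def)
  have key: "0 \<le> s * (b * A + (s * I / k - ?n * A) / (q + 1) + m * X)" if s: "\<bar>s\<bar> = 1" for s :: real
  proof (rule one_sided_derivative_bound[OF _ s e(1)])
    show "(R s has_real_derivative (b * A + (s * I / k - ?n * A) / (q + 1))) (at 0)"
      unfolding R_def[abs_def] using pos
      by (auto intro!: derivative_eq_intros simp: add_divide_distrib diff_divide_distrib)
    show "- (s * t) * (m * X) - t * e t \<le> R s (s * t) - R s 0" if t: "0 < t" "t < 1 / 2" for t
    proof -
      have st: "\<bar>s * t\<bar> < 1 / 2"
        using s t by (auto simp: abs_mult)
      have "s = 1 \<or> s = - 1"
        using s by (auto simp: abs_if split: if_splits)
      then have "\<bar>ln (1 + s * t)\<bar> = s * ln (1 + s * t)"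
        using t by auto
      then have "(\<integral>p. Gi (s * t) p \<partial>?M) \<le> R s (s * t)"
        using U(2)[OF st] Gi(2)[OF st] by (simp only: R_def qA)
      moreover have "(\<integral>p. Gi 0 p \<partial>?M) = A"
        using Gi(2)[of 0] U0 by simp
      ultimately show ?thesis
        using e(2)[OF s t] R0[of s] by linarith
    qed
  qed
  show "\<bar>m * X + b * A - ?n * A / (q + 1)\<bar> \<le> I / (k * (q + 1))"
    using key[of 1] key[of "- 1"] by (simp add: add_divide_distrib diff_divide_distrib abs_le_iff algebra_simps)
qed

subsection \<open>The weighted Pohozaev identity\<close>

text \<open>Fubini: multiply the equation for \<open>w\<close> by \<open>h x * f x\<close> and
  integrate; the powers of \<open>norm x\<close> cancel. With \<open>h = 1\<close> this identifies
  the energies of the two equations, and with \<open>h\<close> the cutoff it gives their localised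
  versions.\<close>

lemma weighted_riesz_energy:
  fixes w f g h :: "'a::euclidean_space \<Rightarrow> real"
  assumes [measurable]: "w \<in> borel_measurable borel" "f \<in> borel_measurable borel"
      "g \<in> borel_measurable borel" "h \<in> borel_measurable borel"
    and w: "\<And>x. x \<noteq> 0 \<Longrightarrow> 0 < w x" and f0: "\<And>x. 0 \<le> f x" and g: "\<And>x. 0 \<le> g x"
    and h: "\<And>x. 0 \<le> h x" "\<And>x. h x \<le> 1"
    and f: "\<And>x. x \<noteq> 0 \<Longrightarrow> f x = w x powr q * norm x powr (- b)"
    and wint: "integrable lborel (\<lambda>x. w x powr (q + 1))"
    and sol: "\<And>x. x \<noteq> 0 \<Longrightarrow>
      has_bochner_integral lborel (\<lambda>y. g y * norm (x - y) powr (- m)) (norm x powr b * w x)"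
  shows "integrable (lborel \<Otimes>\<^sub>M lborel) (\<lambda>(x, y). h x * (f x * g y * norm (x - y) powr (- m)))"
    and "(\<integral>(x, y). h x * (f x * g y * norm (x - y) powr (- m)) \<partial>(lborel \<Otimes>\<^sub>M lborel))
      = (\<integral>x. h x * w x powr (q + 1) \<partial>lborel)"
proof -
  define G where "G = (\<lambda>(x, y). h x * (f x * g y * norm (x - y) powr (- m)))"
  have [measurable]: "G \<in> borel_measurable (lborel \<Otimes>\<^sub>M lborel)"
    unfolding G_def split_beta' by measurable
  have G0: "0 \<le> G p" for p
    using f0 g h by (auto simp: G_def split: prod.splits)
  have hw: "integrable lborel (\<lambda>x. h x * w x powr (q + 1))"
    by (rule Bochner_Integration.integrable_bound[OF wint])
      (auto simp: abs_mult h intro!: AE_I2 mult_left_le_one_le)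
  have inner: "AE x in lborel. has_bochner_integral lborel (\<lambda>y. G (x, y)) (h x * w x powr (q + 1))"
    using AE_lborel_singleton[of 0]
  proof eventually_elim
    case (elim x)
    have "h x * f x * (norm x powr b * w x) = h x * (w x powr q * w x) * (norm x powr (- b) * norm x powr b)"
      using f[OF elim] by (simp add: mult_ac)
    also have "\<dots> = h x * w x powr (q + 1)"
      using w[OF elim] elim by (simp add: powr_add powr_minus)
    finally have eq: "h x * f x * (norm x powr b * w x) = h x * w x powr (q + 1)" .
    show ?case
      using has_bochner_integral_mult_right[OF sol[OF elim], of "h x * f x"]
      unfolding eq by (simp add: G_def mult_ac)
  qed
  then have inner': "AE x in lborel. (\<integral>y. G (x, y) \<partial>lborel) = h x * w x powr (q + 1)"
    by eventually_elim (simp add: has_bochner_integral_iff)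
  have int: "integrable (lborel \<Otimes>\<^sub>M lborel) G"
  proof (rule lborel_pair.Fubini_integrable)
    have "integrable lborel (\<lambda>x. \<integral>y. G (x, y) \<partial>lborel)"
      using hw by (rule integrable_cong_AE[THEN iffD2, rotated -1]) (use inner' in auto)
    then show "integrable lborel (\<lambda>x. \<integral>y. norm (G (x, y)) \<partial>lborel)"
      using G0 by simp
    show "AE x in lborel. integrable lborel (\<lambda>y. G (x, y))"
      using inner by eventually_elim (simp add: has_bochner_integral_iff)
  qed simp
  then show "integrable (lborel \<Otimes>\<^sub>M lborel) (\<lambda>(x, y). h x * (f x * g y * norm (x - y) powr (- m)))"
    by (simp add: G_def)
  have "(\<integral>p. G p \<partial>(lborel \<Otimes>\<^sub>M lborel)) = (\<integral>x. \<integral>y. G (x, y) \<partial>lborel \<partial>lborel)"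
    by (rule lborel_pair.integral_fst'[OF int, symmetric])
  also have "\<dots> = (\<integral>x. h x * w x powr (q + 1) \<partial>lborel)"
    by (rule integral_cong_AE) (use inner' in auto)
  finally show "(\<integral>(x, y). h x * (f x * g y * norm (x - y) powr (- m)) \<partial>(lborel \<Otimes>\<^sub>M lborel))
      = (\<integral>x. h x * w x powr (q + 1) \<partial>lborel)"
    by (simp add: G_def)
qed

text \<open>The first two terms are the inner product of
  \<open>log_cutoff k x *\<^sub>R x - log_cutoff k y *\<^sub>R y\<close> with \<open>x - y\<close>,
  so the sum of the two singular kernels carries a factor of order
  \<open>(norm (x - y))\<^sup>2\<close>. This cancels the two extra inverse powers and leaves a
  bound by the original kernel.\<close>

lemma log_cutoff_field_estimate:
  fixes x y :: "'a::real_inner"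
  assumes "k > 0" "x \<noteq> 0" "y \<noteq> 0"
  shows "\<bar>log_cutoff k x * (x \<bullet> (x - y)) + log_cutoff k y * (y \<bullet> (y - x)) - (norm (x - y))\<^sup>2\<bar>
    \<le> (1 / k + (1 - log_cutoff k x) + (1 - log_cutoff k y)) * (norm (x - y))\<^sup>2"
proof -
  \<comment> \<open>Taking \<open>y\<close> to be the point of smaller norm, the difference of the
    cutoffs is multiplied by \<open>y\<close>, which is the weight in the Lipschitz
    estimate.\<close>
  have *: "\<bar>log_cutoff k x * (x \<bullet> (x - y)) + log_cutoff k y * (y \<bullet> (y - x)) - (norm (x - y))\<^sup>2\<bar>
    \<le> (1 / k + (1 - log_cutoff k x)) * (norm (x - y))\<^sup>2"
    if "norm y \<le> norm x" "x \<noteq> 0" "y \<noteq> 0" for x y :: 'a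
  proof -
    have "log_cutoff k x * (x \<bullet> (x - y)) + log_cutoff k y * (y \<bullet> (y - x)) - (norm (x - y))\<^sup>2
      = (log_cutoff k x - log_cutoff k y) * (y \<bullet> (x - y)) - (1 - log_cutoff k x) * (norm (x - y))\<^sup>2"
      unfolding power2_norm_eq_inner inner_diff_left inner_diff_right
      by (simp add: algebra_simps inner_commute)
    moreover have "\<bar>(log_cutoff k x - log_cutoff k y) * (y \<bullet> (x - y))\<bar> \<le> 1 / k * (norm (x - y))\<^sup>2"
    proof -
      have "\<bar>(log_cutoff k x - log_cutoff k y) * (y \<bullet> (x - y))\<bar>
        \<le> \<bar>log_cutoff k x - log_cutoff k y\<bar> * (norm y * norm (x - y))"
        unfolding abs_mult by (intro mult_left_mono Cauchy_Schwarz_ineq2) auto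
      also have "\<dots> = (\<bar>log_cutoff k x - log_cutoff k y\<bar> * min (norm x) (norm y)) * norm (x - y)"
        using that by (simp add: min_absorb2)
      also have "\<dots> \<le> (norm (x - y) / k) * norm (x - y)"
        using that assms(1) by (intro mult_right_mono log_cutoff_lipschitz) auto
      finally show ?thesis by (simp add: power2_eq_square)
    qed
    moreover have "0 \<le> (1 - log_cutoff k x) * (norm (x - y))\<^sup>2"
      using log_cutoff_le_1[OF assms(1), of x] by simp
    ultimately show ?thesis by (simp add: distrib_right)
  qed
  have "0 \<le> (1 - log_cutoff k x) * (norm (x - y))\<^sup>2" "0 \<le> (1 - log_cutoff k y) * (norm (x - y))\<^sup>2"
    by (simp_all add: log_cutoff_le_1[OF assms(1)])
  then show ?thesis
    using *[of y x] *[of x y] assms(2,3) unfolding distrib_right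
    by (cases "norm y \<le> norm x") (auto simp: norm_minus_commute add.commute)
qed

text \<open>Add the two localised identities. Separately their singular integrals have no bound
  uniform in \<open>k\<close>, but their sum differs from the energy \<open>I\<close> by at most
  \<open>I / k + (I - A\<^sub>1 k) + (I - A\<^sub>2 k)\<close>. As \<open>k\<close> grows this
  vanishes, leaving \<open>I\<close> times the claimed identity, and
  \<open>I \<noteq> 0\<close>.\<close>

lemma weighted_riesz_pohozaev:
  fixes w\<^sub>1 w\<^sub>2 f\<^sub>1 f\<^sub>2 :: "'a::euclidean_space \<Rightarrow> real" and m q\<^sub>1 q\<^sub>2 b\<^sub>1 b\<^sub>2 :: real
  assumes [measurable]: "w\<^sub>1 \<in> borel_measurable borel" "w\<^sub>2 \<in> borel_measurable borel"
      "f\<^sub>1 \<in> borel_measurable borel" "f\<^sub>2 \<in> borel_measurable borel"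
    and m: "0 < m" and q: "0 < q\<^sub>1" "0 < q\<^sub>2"
    and w: "\<And>x. x \<noteq> 0 \<Longrightarrow> 0 < w\<^sub>1 x" "\<And>x. x \<noteq> 0 \<Longrightarrow> 0 < w\<^sub>2 x"
    and f0: "\<And>x. 0 \<le> f\<^sub>1 x" "\<And>x. 0 \<le> f\<^sub>2 x"
    and f: "\<And>x. x \<noteq> 0 \<Longrightarrow> f\<^sub>1 x = w\<^sub>1 x powr q\<^sub>1 * norm x powr (- b\<^sub>1)"
      "\<And>x. x \<noteq> 0 \<Longrightarrow> f\<^sub>2 x = w\<^sub>2 x powr q\<^sub>2 * norm x powr (- b\<^sub>2)"
    and wint: "integrable lborel (\<lambda>x. w\<^sub>1 x powr (q\<^sub>1 + 1))" "integrable lborel (\<lambda>x. w\<^sub>2 x powr (q\<^sub>2 + 1))"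
    and sol: "\<And>x. x \<noteq> 0 \<Longrightarrow>
        has_bochner_integral lborel (\<lambda>y. f\<^sub>2 y * norm (x - y) powr (- m)) (norm x powr b\<^sub>1 * w\<^sub>1 x)"
      "\<And>x. x \<noteq> 0 \<Longrightarrow>
        has_bochner_integral lborel (\<lambda>y. f\<^sub>1 y * norm (x - y) powr (- m)) (norm x powr b\<^sub>2 * w\<^sub>2 x)"
    and J: "\<And>k. 0 < k \<Longrightarrow> integrable (lborel \<Otimes>\<^sub>M lborel)
        (\<lambda>(x, y). log_cutoff k x * norm x * (f\<^sub>1 x * f\<^sub>2 y * norm (x - y) powr (- m - 1)))"
      "\<And>k. 0 < k \<Longrightarrow> integrable (lborel \<Otimes>\<^sub>M lborel)
        (\<lambda>(x, y). log_cutoff k x * norm x * (f\<^sub>2 x * f\<^sub>1 y * norm (x - y) powr (- m - 1)))"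
  shows "m + b\<^sub>1 + b\<^sub>2 = real DIM('a) * (1 / (q\<^sub>1 + 1) + 1 / (q\<^sub>2 + 1))"
proof -
  let ?M = "lborel \<Otimes>\<^sub>M lborel :: ('a \<times> 'a) measure"
  let ?n = "real DIM('a)"
  define K where "K = (\<lambda>(x, y). f\<^sub>1 x * f\<^sub>2 y * norm (x - y) powr (- m))"
  define I where "I = (\<integral>x. w\<^sub>1 x powr (q\<^sub>1 + 1) \<partial>lborel)"
  define A\<^sub>1 where "A\<^sub>1 k = (\<integral>x. log_cutoff k x * w\<^sub>1 x powr (q\<^sub>1 + 1) \<partial>lborel)" for k
  define A\<^sub>2 where "A\<^sub>2 k = (\<integral>x. log_cutoff k x * w\<^sub>2 x powr (q\<^sub>2 + 1) \<partial>lborel)" for k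
  define H where "H k = (\<lambda>(x, y). log_cutoff k x * f\<^sub>1 x * f\<^sub>2 y * ((x \<bullet> (x - y)) * norm (x - y) powr (- m - 2)))" for k
  define H' where "H' k = (\<lambda>(x, y). log_cutoff k x * f\<^sub>2 x * f\<^sub>1 y * ((x \<bullet> (x - y)) * norm (x - y) powr (- m - 2)))" for k
  have K0: "0 \<le> K p" for p
    using f0 by (auto simp: K_def split: prod.splits)
  note E\<^sub>1 = weighted_riesz_energy[OF assms(1,3,4) _ w(1) f0(1,2) _ _ f(1) wint(1) sol(1)]
  note E\<^sub>2 = weighted_riesz_energy[OF assms(2,4,3) _ w(2) f0(2,1) _ _ f(2) wint(2) sol(2)]
  have swap: "integrable ?M (\<lambda>(x, y). F y x)" "(\<integral>(x, y). F y x \<partial>?M) = (\<integral>(x, y). F x y \<partial>?M)"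
    if "integrable ?M (\<lambda>(x, y). F x y)" for F :: "'a \<Rightarrow> 'a \<Rightarrow> real"
    using lborel_pair.integrable_product_swap[OF that]
      lborel_pair.integral_product_swap[OF borel_measurable_integrable[OF that]] by auto
  have K: "integrable ?M K" "(\<integral>p. K p \<partial>?M) = I"
    using E\<^sub>1[of "\<lambda>_. 1"] by (auto simp: K_def I_def)
  \<comment> \<open>Both energies are the double integral of the same kernel \<open>K\<close>, since
    \<open>norm (x - y)\<close> is symmetric.\<close>
  have K\<^sub>2: "(\<integral>x. w\<^sub>2 x powr (q\<^sub>2 + 1) \<partial>lborel) = I"
    using E\<^sub>2(2)[of "\<lambda>_. 1"] swap(2)[of "\<lambda>x y. f\<^sub>2 x * f\<^sub>1 y * norm (x - y) powr (- m)"] E\<^sub>2(1)[of "\<lambda>_. 1"] K(2)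
    by (auto simp: K_def norm_minus_commute mult_ac)
  have A: "\<bar>m * (\<integral>p. H k p \<partial>?M) + b\<^sub>1 * A\<^sub>1 k - ?n * A\<^sub>1 k / (q\<^sub>1 + 1)\<bar> \<le> I / (k * (q\<^sub>1 + 1))"
      "\<bar>m * (\<integral>p. H' k p \<partial>?M) + b\<^sub>2 * A\<^sub>2 k - ?n * A\<^sub>2 k / (q\<^sub>2 + 1)\<bar> \<le> I / (k * (q\<^sub>2 + 1))"
      "integrable ?M (H k)" "integrable ?M (H' k)" if k: "0 < k" for k
    using local_pohozaev[OF assms(1,3,4) m q(1) k w(1) f0(1,2) f(1) wint(1) sol(1) J(1)[OF k]]
      local_pohozaev[OF assms(2,4,3) m q(2) k w(2) f0(2,1) f(2) wint(2) sol(2) J(2)[OF k]]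
    unfolding H_def H'_def A\<^sub>1_def A\<^sub>2_def K\<^sub>2 I_def by auto
  have sum: "\<bar>(\<integral>p. H k p \<partial>?M) + (\<integral>p. H' k p \<partial>?M) - I\<bar> \<le> I / k + (I - A\<^sub>1 k) + (I - A\<^sub>2 k)"
    if k: "0 < k" for k
  proof -
    have cut\<^sub>1: "integrable ?M (\<lambda>(x, y). log_cutoff k x * K (x, y))" "(\<integral>(x, y). log_cutoff k x * K (x, y) \<partial>?M) = A\<^sub>1 k"
      using E\<^sub>1[of "log_cutoff k"] log_cutoff_le_1[OF k] by (auto simp: K_def A\<^sub>1_def)
    have "integrable ?M (\<lambda>(x, y). log_cutoff k x * K (y, x))" "(\<integral>(x, y). log_cutoff k x * K (y, x) \<partial>?M) = A\<^sub>2 k"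
      using E\<^sub>2[of "log_cutoff k"] log_cutoff_le_1[OF k] by (auto simp: K_def A\<^sub>2_def norm_minus_commute mult_ac)
    then have cut\<^sub>2: "integrable ?M (\<lambda>(x, y). log_cutoff k y * K (x, y))" "(\<integral>(x, y). log_cutoff k y * K (x, y) \<partial>?M) = A\<^sub>2 k"
      using swap[of "\<lambda>x y. log_cutoff k x * K (y, x)"] by auto
    \<comment> \<open>Exchanging the variables in \<open>H'\<close> puts both singular integrands
      over the common density \<open>f\<^sub>1 x * f\<^sub>2 y\<close>.\<close>
    have H': "integrable ?M (\<lambda>(x, y). H' k (y, x))" "(\<integral>(x, y). H' k (y, x) \<partial>?M) = (\<integral>p. H' k p \<partial>?M)"
      using swap[of "\<lambda>x y. H' k (x, y)"] A(4)[OF k] by auto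
    let ?D = "\<lambda>(x, y). H k (x, y) + H' k (y, x) - K (x, y)"
    let ?B = "\<lambda>(x, y). 1 / k * K (x, y) + (K (x, y) - log_cutoff k x * K (x, y)) + (K (x, y) - log_cutoff k y * K (x, y))"
    have D: "integrable ?M ?D" "(\<integral>p. ?D p \<partial>?M) = (\<integral>p. H k p \<partial>?M) + (\<integral>p. H' k p \<partial>?M) - I"
      using A(3)[OF k] H' K by (auto simp: split_beta')
    have B: "integrable ?M ?B" "(\<integral>p. ?B p \<partial>?M) = I / k + (I - A\<^sub>1 k) + (I - A\<^sub>2 k)"
      using cut\<^sub>1 cut\<^sub>2 K by (auto simp: split_beta')
    have "AE p in ?M. \<bar>?D p\<bar> \<le> ?B p"
    proof -
      have "AE p in ?M. fst p \<noteq> 0 \<and> snd p \<noteq> 0"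
      proof (rule lborel_pair.AE_pair_measure)
        show "AE x in lborel. AE y in lborel. fst (x, y) \<noteq> (0::'a) \<and> snd (x, y) \<noteq> (0::'a)"
          using AE_lborel_singleton[of "0::'a"]
          by eventually_elim (use AE_lborel_singleton[of "0::'a"] in auto)
      qed measurable
      then show ?thesis
      proof eventually_elim
        case (elim p)
        obtain x y where p: "p = (x, y)" by force
        define z where "z = norm (x - y)"
        \<comment> \<open>Valid on the diagonal too, where both sides are 0.\<close>
        have zz: "z powr (- m - 2) * z\<^sup>2 = z powr (- m)"
          by (cases "z = 0") (auto simp: z_def powr_diff)
        have "\<bar>?D p\<bar> = f\<^sub>1 x * f\<^sub>2 y * z powr (- m - 2) *
            \<bar>log_cutoff k x * (x \<bullet> (x - y)) + log_cutoff k y * (y \<bullet> (y - x)) - z\<^sup>2\<bar>"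
        proof -
          have "?D p = f\<^sub>1 x * f\<^sub>2 y * z powr (- m - 2) *
            (log_cutoff k x * (x \<bullet> (x - y)) + log_cutoff k y * (y \<bullet> (y - x)) - z\<^sup>2)"
            unfolding p H_def H'_def K_def prod.case norm_minus_commute[of y x] z_def[symmetric] zz[symmetric]
            by (simp add: algebra_simps)
          then show ?thesis
            using f0 by (simp add: abs_mult)
        qed
        also have "\<dots> \<le> f\<^sub>1 x * f\<^sub>2 y * z powr (- m - 2) *
            ((1 / k + (1 - log_cutoff k x) + (1 - log_cutoff k y)) * z\<^sup>2)"
          using log_cutoff_field_estimate[OF k, of x y] elim f0
          by (intro mult_left_mono) (auto simp: p z_def)
        also have "\<dots> = ?B p"
          unfolding p K_def prod.case z_def[symmetric] zz[symmetric]
          by (simp add: algebra_simps)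
        finally show ?case .
      qed
    qed
    then have "\<bar>\<integral>p. ?D p \<partial>?M\<bar> \<le> (\<integral>p. ?B p \<partial>?M)"
      using integral_abs_bound[of ?M ?D] integral_mono_AE[OF integrable_abs[OF D(1)] B(1)] by linarith
    then show ?thesis
      unfolding D(2) B(2) .
  qed
  have A_lim: "(\<lambda>j. \<integral>x. log_cutoff (real (Suc j)) x * F x \<partial>lborel) \<longlonglongrightarrow> (\<integral>x. F x \<partial>lborel)"
    if F: "integrable lborel F" for F :: "'a \<Rightarrow> real"
  proof (rule integral_dominated_convergence[where w = "\<lambda>x. \<bar>F x\<bar>"])
    show "AE x in lborel. (\<lambda>j. log_cutoff (real (Suc j)) x * F x) \<longlonglongrightarrow> F x"
      using tendsto_mult[OF log_cutoff_tendsto_1 tendsto_const] by (intro AE_I2) fastforce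
    show "AE x in lborel. norm (log_cutoff (real (Suc j)) x * F x) \<le> \<bar>F x\<bar>" for j
      by (auto simp: abs_mult log_cutoff_le_1 intro!: AE_I2 mult_left_le_one_le)
  qed (use F in auto)
  have A_lims: "(\<lambda>j. A\<^sub>1 (real (Suc j))) \<longlonglongrightarrow> I" "(\<lambda>j. A\<^sub>2 (real (Suc j))) \<longlonglongrightarrow> I"
    using A_lim[OF wint(1)] A_lim[OF wint(2)] by (auto simp: A\<^sub>1_def A\<^sub>2_def I_def[symmetric] K\<^sub>2)
  \<comment> \<open>\<open>L\<close> is the sum of the two identities with the singular integrals
    replaced by \<open>I\<close>; \<open>r\<close> collects the two localisation errors and the
    error of this replacement.\<close>
  define L where "L j = m * I + b\<^sub>1 * A\<^sub>1 (real (Suc j)) - ?n * A\<^sub>1 (real (Suc j)) / (q\<^sub>1 + 1)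
    + b\<^sub>2 * A\<^sub>2 (real (Suc j)) - ?n * A\<^sub>2 (real (Suc j)) / (q\<^sub>2 + 1)" for j
  define r where "r j = I / (q\<^sub>1 + 1) * (1 / real (Suc j)) + I / (q\<^sub>2 + 1) * (1 / real (Suc j))
    + m * (I * (1 / real (Suc j)) + (I - A\<^sub>1 (real (Suc j))) + (I - A\<^sub>2 (real (Suc j))))" for j
  have inv: "(\<lambda>j. 1 / real (Suc j)) \<longlonglongrightarrow> 0"
    using LIMSEQ_Suc[OF lim_const_over_n[of 1]] by simp
  have "r \<longlonglongrightarrow> I / (q\<^sub>1 + 1) * 0 + I / (q\<^sub>2 + 1) * 0 + m * (I * 0 + (I - I) + (I - I))"
    unfolding r_def[abs_def] by (intro tendsto_intros inv A_lims)
  then have r0: "r \<longlonglongrightarrow> 0" by simp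
  have L_lim: "L \<longlonglongrightarrow> m * I + b\<^sub>1 * I - ?n * I / (q\<^sub>1 + 1) + b\<^sub>2 * I - ?n * I / (q\<^sub>2 + 1)"
    unfolding L_def[abs_def] using q by (intro tendsto_intros A_lims) auto
  have "\<bar>L j\<bar> \<le> r j" for j
  proof -
    define k where "k = real (Suc j)"
    define X Y where "X = (\<integral>p. H k p \<partial>?M)" and "Y = (\<integral>p. H' k p \<partial>?M)"
    have k: "0 < k" by (simp add: k_def)
    have tri: "\<bar>a + b - c\<bar> \<le> A + B + C" if "\<bar>a\<bar> \<le> A" "\<bar>b\<bar> \<le> B" "\<bar>c\<bar> \<le> C" for a b c A B C :: real
      using that by linarith
    have L: "L j = (m * X + b\<^sub>1 * A\<^sub>1 k - ?n * A\<^sub>1 k / (q\<^sub>1 + 1)) + (m * Y + b\<^sub>2 * A\<^sub>2 k - ?n * A\<^sub>2 k / (q\<^sub>2 + 1)) - m * (X + Y - I)"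
      unfolding L_def k_def[symmetric] by (simp add: algebra_simps)
    have "\<bar>m * (X + Y - I)\<bar> \<le> m * (I / k + (I - A\<^sub>1 k) + (I - A\<^sub>2 k))"
      unfolding abs_mult X_def Y_def using sum[OF k] m by (simp add: mult_left_mono)
    then have "\<bar>L j\<bar> \<le> I / (k * (q\<^sub>1 + 1)) + I / (k * (q\<^sub>2 + 1)) + m * (I / k + (I - A\<^sub>1 k) + (I - A\<^sub>2 k))"
      unfolding L by (intro tri A(1,2)[OF k, folded X_def Y_def])
    also have "\<dots> = r j"
      unfolding r_def k_def[symmetric] by (simp add: mult.commute)
    finally show ?thesis .
  qed
  then have "L \<longlonglongrightarrow> 0"
    using r0 by (intro Lim_null_comparison[of L r]) auto
  then have "m * I + b\<^sub>1 * I - ?n * I / (q\<^sub>1 + 1) + b\<^sub>2 * I - ?n * I / (q\<^sub>2 + 1) = 0"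
    using LIMSEQ_unique L_lim by blast
  then have eq: "I * (m + b\<^sub>1 + b\<^sub>2 - ?n * (1 / (q\<^sub>1 + 1) + 1 / (q\<^sub>2 + 1))) = 0"
    by (simp add: algebra_simps)
  have "I \<noteq> 0"
  proof
    assume "I = 0"
    then have "AE x in lborel. w\<^sub>1 x powr (q\<^sub>1 + 1) = 0"
      using integral_nonneg_eq_0_iff_AE[OF wint(1)] by (simp add: I_def)
    with AE_lborel_singleton[of "0::'a"] have "AE x in (lborel :: 'a measure). False"
      by eventually_elim (use w(1) in fastforce)
    then show False
      by (simp add: eventually_False ae_filter_eq_bot_iff)
  qed
  with eq show ?thesis by simp
qed

subsection \<open>The integral system\<close>

text \<open>Since \<open>norm (x - y) \<le> 1 + norm y\<close> for a unit vector \<open>x\<close>,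
  finiteness of the potential at one such point already controls \<open>g\<close> with this
  weight.\<close>

lemma integrable_weight_of_riesz_potential:
  fixes g :: "'a::euclidean_space \<Rightarrow> real"
  assumes [measurable]: "g \<in> borel_measurable borel"
    and g: "\<And>y. 0 \<le> g y" and m: "0 < m" and x: "norm x = 1"
    and int: "integrable lborel (\<lambda>y. g y * norm (x - y) powr (- m))"
  shows "integrable lborel (\<lambda>y. g y * (1 + norm y) powr (- m))"
proof (rule Bochner_Integration.integrable_bound[OF int])
  show "AE y in lborel. norm (g y * (1 + norm y) powr (- m)) \<le> norm (g y * norm (x - y) powr (- m))"
    using AE_lborel_singleton[of x]
  proof eventually_elim
    case (elim y)
    have "(1 + norm y) powr (- m) \<le> norm (x - y) powr (- m)"
      using elim m x norm_triangle_ineq4[of x y] by (intro powr_mono2') auto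
    then show ?case
      using g[of y] by (simp add: abs_mult mult_left_mono)
  qed
qed simp

text \<open>With \<open>p = s / q\<close> the hypothesis reads
  \<open>n < (\<gamma> - 1) * p\<close>. This rearranges to the condition that
  \<open>n - \<gamma> + 1\<close> times the exponent conjugate to \<open>p\<close> is below
  \<open>n\<close>; \<open>p > 1\<close> follows from \<open>\<gamma> - 1 < n\<close>.\<close>

lemma singular_exponent_bound:
  fixes n \<gamma> q s :: real
  assumes "1 < \<gamma>" "\<gamma> < n" "0 < q" "n * q / (\<gamma> - 1) < s"
  shows "1 < s / q" "((n - \<gamma>) + 1) * (s / q) / (s / q - 1) < n"
proof -
  define p where "p = s / q"
  have np: "n < (\<gamma> - 1) * p"
    using assms by (simp add: p_def field_simps)
  have "(\<gamma> - 1) * 1 < n"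
    using assms(1,2) by simp
  also note np
  finally have "1 < p"
    using assms by (simp only: mult_less_cancel_left_pos diff_gt_0_iff_gt)
  with np show "1 < s / q" "((n - \<gamma>) + 1) * (s / q) / (s / q - 1) < n"
    unfolding p_def[symmetric] by (simp_all add: pos_divide_less_eq algebra_simps)
qed

text \<open>The weighted identity with \<open>m = n - \<gamma>\<close>, \<open>b\<^sub>1 = 0\<close>
  and \<open>b\<^sub>2 = \<gamma>\<close>: its left side is \<open>n\<close>, so the reciprocals of
  \<open>q\<^sub>1 + 1\<close> and \<open>q\<^sub>2 + 1\<close> add up to 1, which is the claim
  after clearing denominators.\<close>

theorem theorem1p7:
  fixes u v :: "real ^ 'n \<Rightarrow> real" and \<gamma> q\<^sub>1 q\<^sub>2 :: real
  assumes "1 < \<gamma>" and "\<gamma> < real CARD('n)"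
    and "min q\<^sub>1 q\<^sub>2 > 0"
    and "\<And>x. x \<noteq> 0 \<Longrightarrow> u x > 0" and "\<And>x. x \<noteq> 0 \<Longrightarrow> v x > 0"
    and "\<And>x. x \<noteq> 0 \<Longrightarrow> u differentiable (at x)"
    and "\<And>x. x \<noteq> 0 \<Longrightarrow> v differentiable (at x)"
    and "solves_system \<gamma> q\<^sub>1 q\<^sub>2 u v"
    and "(\<exists>s > real CARD('n) * q\<^sub>1 / (\<gamma> - 1).
            u \<in> Lp_space (q\<^sub>1 + 1) lborel \<inter> Lp_space s lborel \<and> v \<in> Lp_space (q\<^sub>2 + 1) lborel) \<or>
         (\<exists>s > real CARD('n) * q\<^sub>2 / (\<gamma> - 1).
            u \<in> Lp_space (q\<^sub>1 + 1) lborel \<and> v \<in> Lp_space (q\<^sub>2 + 1) lborel \<inter> Lp_space s lborel)"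
  shows "q\<^sub>1 * q\<^sub>2 = 1"
proof -
  let ?n = "real CARD('n)"
  define m where "m = ?n - \<gamma>"
  define f g where "f x = u x powr q\<^sub>1" and "g x = v x powr q\<^sub>2 * norm x powr (- \<gamma>)" for x
  have q: "0 < q\<^sub>1" "0 < q\<^sub>2" and m: "0 < m"
    using assms(2,3) by (auto simp: m_def)
  have Lp: "u \<in> Lp_space (q\<^sub>1 + 1) lborel" "v \<in> Lp_space (q\<^sub>2 + 1) lborel"
    using assms(9) by auto
  then have meas [measurable]: "u \<in> borel_measurable borel" "v \<in> borel_measurable borel"
    by (auto simp: Lp_space_def)
  have fg_meas [measurable]: "f \<in> borel_measurable borel" "g \<in> borel_measurable borel"
    unfolding f_def[abs_def] g_def[abs_def] by measurable
  have nonneg: "0 \<le> f x" "0 \<le> g x" for x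
    by (auto simp: f_def g_def)
  have wint: "integrable lborel (\<lambda>x. w x powr p)"
    if "w \<in> Lp_space p lborel" "\<And>x. x \<noteq> 0 \<Longrightarrow> 0 < w x" for w :: "real ^ 'n \<Rightarrow> real" and p
  proof -
    have [measurable]: "w \<in> borel_measurable borel"
      using that(1) by (simp add: Lp_space_def)
    \<comment> \<open>The value at the origin is unconstrained and may be negative, so the absolute
      value is removed only almost everywhere.\<close>
    have "AE x in lborel. \<bar>w x\<bar> powr p = w x powr p"
      using AE_lborel_singleton[of "0 :: real ^ 'n"] by eventually_elim (use that(2) in force)
    then have "integrable lborel (\<lambda>x. \<bar>w x\<bar> powr p) \<longleftrightarrow> integrable lborel (\<lambda>x. w x powr p)"
      by (intro integrable_cong_AE) auto
    then show ?thesis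
      using that(1) by (simp add: Lp_space_def)
  qed
  \<comment> \<open>The weight of the first equation depends on \<open>y\<close> and is absorbed
    into \<open>g\<close>; that of the second depends on \<open>x\<close> and moves to the left
    side. The factor \<open>norm x powr 0\<close> casts the first equation in the general
    form.\<close>
  have sol_u: "has_bochner_integral lborel (\<lambda>y. g y * norm (x - y) powr (- m)) (norm x powr 0 * u x)"
    and sol_v: "has_bochner_integral lborel (\<lambda>y. f y * norm (x - y) powr (- m)) (norm x powr \<gamma> * v x)"
    if "x \<noteq> 0" for x
  proof -
    have u: "has_bochner_integral lborel (\<lambda>y. v y powr q\<^sub>2 / (norm (x - y) powr m * norm y powr \<gamma>)) (u x)"
      and v: "has_bochner_integral lborel (\<lambda>y. u y powr q\<^sub>1 / (norm (x - y) powr m * norm x powr \<gamma>)) (v x)"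
      using assms(8) that by (auto simp: solves_system_def m_def)
    show "has_bochner_integral lborel (\<lambda>y. g y * norm (x - y) powr (- m)) (norm x powr 0 * u x)"
      using u that by (simp add: g_def powr_minus divide_inverse mult_ac)
    show "has_bochner_integral lborel (\<lambda>y. f y * norm (x - y) powr (- m)) (norm x powr \<gamma> * v x)"
      using has_bochner_integral_mult_right[OF v, of "norm x powr \<gamma>"] that
      by (simp add: f_def powr_minus_divide mult.commute[of "norm _ powr m"])
  qed
  \<comment> \<open>False at the origin, since \<open>0 powr 0 = 0\<close>.\<close>
  have f: "f x = u x powr q\<^sub>1 * norm x powr (- 0)" if "x \<noteq> 0" for x
    using that by (simp add: f_def)
  have g: "g x = v x powr q\<^sub>2 * norm x powr (- \<gamma>)" for x
    by (simp add: g_def)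
  have fg: "integrable (lborel \<Otimes>\<^sub>M lborel) (\<lambda>(x, y). f x * g y * norm (x - y) powr (- m))"
    using weighted_riesz_energy(1)[OF meas(1) fg_meas _ assms(4) nonneg _ _ f wint[OF Lp(1) assms(4)] sol_u, of "\<lambda>_. 1"]
    by simp
  have gf: "integrable (lborel \<Otimes>\<^sub>M lborel) (\<lambda>(x, y). g x * f y * norm (x - y) powr (- m))"
    using lborel_pair.integrable_product_swap[OF fg] by (simp add: norm_minus_commute mult_ac)
  obtain e :: "real ^ 'n" where "e \<in> Basis"
    using nonempty_Basis by blast
  then have e: "norm e = 1" "e \<noteq> 0"
    by auto
  have fw: "integrable lborel (\<lambda>y. f y * (1 + norm y) powr (- m))"
    and gw: "integrable lborel (\<lambda>y. g y * (1 + norm y) powr (- m))"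
    using sol_u[OF e(2)] sol_v[OF e(2)] unfolding has_bochner_integral_iff
    by (auto intro!: integrable_weight_of_riesz_potential[OF _ _ m e(1)] nonneg)
  \<comment> \<open>Supplies the dominating function \<open>h = \<bar>w\<bar> powr q\<close> with
    exponent \<open>p = s / q\<close>, so that its \<open>p\<close>-th power is
    \<open>\<bar>w\<bar> powr s\<close>.\<close>
  have power: "integrable lborel (\<lambda>x. (\<bar>w x\<bar> powr q) powr (s / q))"
    if "w \<in> Lp_space s lborel" "0 < q" for w :: "real ^ 'n \<Rightarrow> real" and s q
    using that by (simp add: Lp_space_def powr_powr)
  have J: "integrable (lborel \<Otimes>\<^sub>M lborel)
        (\<lambda>(x, y). log_cutoff k x * norm x * (f x * g y * norm (x - y) powr (- m - 1))) \<and>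
      integrable (lborel \<Otimes>\<^sub>M lborel)
        (\<lambda>(x, y). log_cutoff k x * norm x * (g x * f y * norm (x - y) powr (- m - 1)))"
    if k: "0 < k" for k
    using assms(9)
  proof (elim disjE exE conjE)
    fix s
    assume s: "?n * q\<^sub>1 / (\<gamma> - 1) < s" "u \<in> Lp_space (q\<^sub>1 + 1) lborel \<inter> Lp_space s lborel"
    note p = singular_exponent_bound[OF assms(1,2) q(1) s(1), folded m_def]
    have "\<exists>C\<ge>0. \<forall>x. d \<le> norm x \<longrightarrow> f x \<le> C * \<bar>u x\<bar> powr q\<^sub>1" if "0 < d" for d
    proof (intro exI[of _ 1] conjI allI impI)
      fix x :: "real ^ 'n"
      assume "d \<le> norm x"
      then have "x \<noteq> 0" using that by auto
      then show "f x \<le> 1 * \<bar>u x\<bar> powr q\<^sub>1"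
        using assms(4)[of x] by (simp add: f_def)
    qed simp
    with integrable_log_cutoff_kernel[OF fg_meas _ nonneg _ m p(1) _ fg gw power[of u s q\<^sub>1] _ k] p(2) s(2) q
    show ?thesis by simp
  next
    fix s
    assume s: "?n * q\<^sub>2 / (\<gamma> - 1) < s" "v \<in> Lp_space (q\<^sub>2 + 1) lborel \<inter> Lp_space s lborel"
    note p = singular_exponent_bound[OF assms(1,2) q(2) s(1), folded m_def]
    have "\<exists>C\<ge>0. \<forall>x. d \<le> norm x \<longrightarrow> g x \<le> C * \<bar>v x\<bar> powr q\<^sub>2" if "0 < d" for d
    \<comment> \<open>Under the second alternative \<open>g\<close> takes the role of the more
      integrable factor; away from the origin its weight is at most
      \<open>d powr (- \<gamma>)\<close>.\<close>
    proof (intro exI[of _ "d powr (- \<gamma>)"] conjI allI impI)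
      fix x :: "real ^ 'n"
      assume d: "d \<le> norm x"
      then have "x \<noteq> 0" using that by auto
      then have "g x = norm x powr (- \<gamma>) * \<bar>v x\<bar> powr q\<^sub>2"
        using assms(5)[of x] by (simp add: g_def)
      also have "\<dots> \<le> d powr (- \<gamma>) * \<bar>v x\<bar> powr q\<^sub>2"
        using d that assms(1) by (intro mult_right_mono powr_mono2') auto
      finally show "g x \<le> d powr (- \<gamma>) * \<bar>v x\<bar> powr q\<^sub>2" .
    qed simp
    with integrable_log_cutoff_kernel[OF fg_meas(2,1) _ nonneg(2,1) _ m p(1) _ gf fw power[of v s q\<^sub>2] _ k] p(2) s(2) q
    show ?thesis by simp
  qed
  have "m + 0 + \<gamma> = real DIM(real ^ 'n) * (1 / (q\<^sub>1 + 1) + 1 / (q\<^sub>2 + 1))"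
    by (rule weighted_riesz_pohozaev[OF meas fg_meas m q assms(4,5) nonneg f g
          wint[OF Lp(1) assms(4)] wint[OF Lp(2) assms(5)] sol_u sol_v])
      (use J in auto)
  then have "?n * (1 / (q\<^sub>1 + 1) + 1 / (q\<^sub>2 + 1)) = ?n * 1"
    by (simp add: m_def)
  then have "1 / (q\<^sub>1 + 1) + 1 / (q\<^sub>2 + 1) = 1"
    using assms(1,2) by simp
  then show ?thesis
    using q by (simp add: field_simps)
qed

end
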